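(* There exists an algorithm that, given a recursively enumerable presentation $\langle S \mid \mathcal{R} \rangle$ (with $S$ a finite alphabet of generators) of a finitely generated just infinite group $G$ and a word $x$ in the generators $S$ (a word in the alphabet $S\cup S^{-1}$), decides whether the equality $x=1$ holds in the group $G$. That is, a single algorithm, which takes the pair (presentation, word) as input, halts with the correct answer on every such input for which the presented group is just infinite (nothing is required on other inputs).
   Context: A group $G$ is just infinite if it is infinite and for every non-trivial normal subgroup $H\triangleleft G$ the quotient $G/H$ is finite. A recursively enumerable presentation of a finitely generated group $G$ is a pair $(S,\mathcal R)$, also written $\langle S\mid\mathcal R\rangle$, consisting of a finite alphabet $S=\{a_1,\dots,a_k\}$ of generators and an algorithm $\mathcal R$ (e.g. a program of a Turing machine, encoded as a finite word) that enumerates a set of defining relations of $G$, i.e. a set of words in $S\cup S^{-1}$ such that $G$ is the quotient of the free group on $S$ by the normal closure of this set. The presentation is given to the algorithm as the pair ($S$, code of $\mathcal R$). *)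

theory Defs
  imports "HOL-Library.Nat_Bijection" "HOL-Algebra.Coset"
begin

section \<open>Algorithms: partial recursive functions\<close>

text \<open>
  Algorithms are programs for the partial recursive functions in Kleene's sense: zero, successor,
  projections, composition, primitive recursion and unbounded minimisation.
\<close>

datatype program =
    Zero
  | Succ
  | Proj nat
  | Comp program "program list"
  | PrimRec program program
  | Mu program

text \<open>
  \<open>run p xs = Some y\<close> says that \<open>p\<close> halts on the arguments \<open>xs\<close> with output \<open>y\<close>, and
  \<open>run p xs = None\<close> that it does not halt (or is applied to too few arguments). Evaluation is
  strict: a composition diverges if one of its inner programs does, and the search performed by
  \<open>Mu p\<close> diverges if \<open>p\<close> diverges before a zero has been reached.
\<close>

fun run :: "program \<Rightarrow> nat list \<Rightarrow> nat option" where
  "run Zero xs = Some 0"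
| "run Succ [] = None"
| "run Succ (x # xs) = Some (Suc x)"
| "run (Proj i) xs = (if i < length xs then Some (xs ! i) else None)"
| "run (Comp p qs) xs =
    (if \<forall>q\<in>set qs. run q xs \<noteq> None
     then run p (map (\<lambda>q. the (run q xs)) qs) else None)"
| "run (PrimRec p q) [] = None"
| "run (PrimRec p q) (n # xs) =
    rec_nat (run p xs) (\<lambda>m r. case r of None \<Rightarrow> None | Some y \<Rightarrow> run q (m # y # xs)) n"
| "run (Mu p) xs =
    (if \<exists>n. run p (n # xs) = Some 0 \<and> (\<forall>m<n. run p (m # xs) \<noteq> None)
     then Some (LEAST n. run p (n # xs) = Some 0) else None)"

text \<open>Goedel numbers, through which programs are handed to other programs.\<close>

fun code_program :: "program \<Rightarrow> nat" where
  "code_program Zero = prod_encode (0, 0)"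
| "code_program Succ = prod_encode (1, 0)"
| "code_program (Proj i) = prod_encode (2, i)"
| "code_program (Comp p qs) =
    prod_encode (3, prod_encode (code_program p, list_encode (map code_program qs)))"
| "code_program (PrimRec p q) = prod_encode (4, prod_encode (code_program p, code_program q))"
| "code_program (Mu p) = prod_encode (5, code_program p)"

lemma code_program_inject: "code_program p = code_program q \<Longrightarrow> p = q"
proof (induction p arbitrary: q)
  case (Comp p ps)
  from Comp.prems obtain q' qs where q: "q = Comp q' qs"
    by (cases q) (auto simp: prod_encode_eq)
  from Comp.prems have "map code_program ps = map code_program qs"
    by (simp add: q prod_encode_eq list_encode_eq)
  moreover have "map code_program ps = map code_program qs \<Longrightarrow> ps = qs"
    using Comp.IH(2)
  proof (induction ps arbitrary: qs)
    case (Cons a ps)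
    then show ?case by (cases qs) auto
  qed simp
  ultimately show ?case
    using Comp by (auto simp: q prod_encode_eq)
qed (case_tac q; simp add: prod_encode_eq)+

section \<open>Words and free groups\<close>

text \<open>
  The letter \<open>(i, True)\<close> stands for the generator \<open>a\<^sub>i\<close> and \<open>(i, False)\<close> for its inverse; the
  alphabet with \<open>k\<close> generators is \<open>a\<^sub>0, \<dots>, a\<^sub>k\<^sub>-\<^sub>1\<close>.
\<close>

type_synonym letter = "nat \<times> bool"
type_synonym word = "letter list"

definition letters :: "nat \<Rightarrow> letter set" where
  "letters k = {..<k} \<times> UNIV"

definition words :: "nat \<Rightarrow> word set" where
  "words k = lists (letters k)"

fun inv_letter :: "letter \<Rightarrow> letter" where
  "inv_letter (i, b) = (i, \<not> b)"

fun code_letter :: "letter \<Rightarrow> nat" where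
  "code_letter (i, b) = 2 * i + (if b then 0 else 1)"

definition code_word :: "word \<Rightarrow> nat" where
  "code_word w = list_encode (map code_letter w)"

lemma inj_code_letter: "inj code_letter"
proof (rule injI)
  fix a b assume *: "code_letter a = code_letter b"
  obtain i s j t where ab: "a = (i, s)" "b = (j, t)" by fastforce
  from * show "a = b" unfolding ab by (auto split: if_splits) presburger+
qed

lemma inj_code_word: "inj code_word"
  by (auto simp: inj_def code_word_def list_encode_eq inj_map_eq_map[OF inj_code_letter])

inductive_set free_eq :: "nat \<Rightarrow> (word \<times> word) set" for k where
  refl: "u \<in> words k \<Longrightarrow> (u, u) \<in> free_eq k"
| sym: "(u, v) \<in> free_eq k \<Longrightarrow> (v, u) \<in> free_eq k"
| trans: "(u, v) \<in> free_eq k \<Longrightarrow> (v, w) \<in> free_eq k \<Longrightarrow> (u, w) \<in> free_eq k"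
| cancel: "u \<in> words k \<Longrightarrow> v \<in> words k \<Longrightarrow> a \<in> letters k
    \<Longrightarrow> (u @ [a, inv_letter a] @ v, u @ v) \<in> free_eq k"

definition free_class :: "nat \<Rightarrow> word \<Rightarrow> word set" where
  "free_class k w = free_eq k `` {w}"

text \<open>The product of two classes is the class of the concatenations of their members.\<close>

definition free_group :: "nat \<Rightarrow> word set monoid" where
  "free_group k =
    \<lparr>carrier = words k // free_eq k,
     mult = (\<lambda>U V. free_eq k `` {u @ v | u v. u \<in> U \<and> v \<in> V}),
     one = free_class k []\<rparr>"

section \<open>Presentations and just infinite groups\<close>

definition normal_closure :: "('a, 'b) monoid_scheme \<Rightarrow> 'a set \<Rightarrow> 'a set" where
  "normal_closure G A = \<Inter>{N. N \<lhd> G \<and> A \<subseteq> N}"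

definition relators_closure :: "nat \<Rightarrow> word set \<Rightarrow> word set set" where
  "relators_closure k R = normal_closure (free_group k) (free_class k ` R)"

definition presented_group :: "nat \<Rightarrow> word set \<Rightarrow> word set set monoid" where
  "presented_group k R = free_group k Mod relators_closure k R"

definition word_value :: "nat \<Rightarrow> word set \<Rightarrow> word \<Rightarrow> word set set" where
  "word_value k R w = relators_closure k R #>\<^bsub>free_group k\<^esub> free_class k w"

definition just_infinite :: "('a, 'b) monoid_scheme \<Rightarrow> bool" where
  "just_infinite G \<longleftrightarrow>
    group G \<and> infinite (carrier G) \<and>
    (\<forall>H. H \<lhd> G \<longrightarrow> H \<noteq> {\<one>\<^bsub>G\<^esub>} \<longrightarrow> finite (carrier (G Mod H)))"

text \<open>
  A program enumerates the set of its outputs on the inputs \<open>0, 1, 2, \<dots>\<close>. It need not halt on all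
  of them, so that the empty set can be enumerated as well.
\<close>

definition enumerates :: "program \<Rightarrow> word set \<Rightarrow> bool" where
  "enumerates p R \<longleftrightarrow> {y. \<exists>n. run p [n] = Some y} = code_word ` R"

definition re_presentation :: "nat \<Rightarrow> program \<Rightarrow> word set \<Rightarrow> bool" where
  "re_presentation k p R \<longleftrightarrow> R \<subseteq> words k \<and> enumerates p R"

definition code_presentation :: "nat \<Rightarrow> program \<Rightarrow> nat" where
  "code_presentation k p = prod_encode (k, code_program p)"

end

theory Submission
  imports Defs
begin

text \<open>
  If \<open>x = 1\<close> in \<open>G = \<langle>S | R\<rangle>\<close>, this is eventually found by enumerating the consequences of \<open>R\<close>. If
  \<open>x \<noteq> 1\<close>, then the normal closure of \<open>x\<close> is non-trivial, so \<open>\<langle>S | R, x\<rangle>\<close> is finite, and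
  finiteness has a certificate whose validity is semidecidable: a finite set of words that contains
  the empty word and is closed, up to consequences of \<open>R, x\<close>, under multiplication by letters on the
  left. If \<open>x = 1\<close>, no such certificate exists, since \<open>\<langle>S | R, x\<rangle> = G\<close> is infinite. Both searches are
  run in parallel.

  A universal machine is not needed: the graph of \<open>run\<close>, like the congruence of words, is the least
  relation closed under finitary rules, hence semidecidable by searching for derivations.
\<close>

section \<open>Computable functions\<close>

text \<open>Two features of the problem shape the proof. The algorithm must be uniform: the number
  of generators, the enumerating program and the word are inputs, not constants. Every closure rule
  is therefore stated for functions of a coded input, and the rule systems that are searched take
  parameters. Moreover, the enumerating program may diverge on some inputs, so it cannot simply be
  run; it enters only through derivable facts about its runs, and an input without output
  contributes no fact. Every search is put in the form that a total computable function has a zero.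
  Divergence is thus confined to one outermost minimisation, and two searches run in parallel by
  minimising the product of their functions. The certificate of finiteness is one-sided by design:
  its words may coincide in the quotient, so no inequality, which in general is not semidecidable,
  has to be verified.\<close>

definition computable_fun :: "nat \<Rightarrow> (nat list \<Rightarrow> nat) \<Rightarrow> bool" where
  "computable_fun k f \<longleftrightarrow> (\<exists>p. \<forall>xs. length xs = k \<longrightarrow> run p xs = Some (f xs))"

lemma computable_fun_nth: "i < k \<Longrightarrow> computable_fun k (\<lambda>xs. xs ! i)"
  unfolding computable_fun_def by (intro exI[of _ "Proj i"]) auto

text \<open>Strictness of \<open>Comp\<close> does no harm here: every inner program halts on lists
  of length \<open>k\<close>.\<close>

lemma computable_fun_compose:
  assumes g: "computable_fun (length fs) g"
    and fs: "\<And>f. f \<in> set fs \<Longrightarrow> computable_fun k f"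
  shows "computable_fun k (\<lambda>xs. g (map (\<lambda>f. f xs) fs))"
proof -
  obtain p where p: "\<And>xs. length xs = length fs \<Longrightarrow> run p xs = Some (g xs)"
    using g unfolding computable_fun_def by blast
  have "\<forall>f\<in>set fs. \<exists>q. \<forall>xs. length xs = k \<longrightarrow> run q xs = Some (f xs)"
    using fs unfolding computable_fun_def by blast
  then obtain Q where Q: "\<And>f xs. f \<in> set fs \<Longrightarrow> length xs = k \<Longrightarrow> run (Q f) xs = Some (f xs)"
    by metis
  have "run (Comp p (map Q fs)) xs = Some (g (map (\<lambda>f. f xs) fs))" if "length xs = k" for xs
  proof -
    have "map (\<lambda>q. the (run q xs)) (map Q fs) = map (\<lambda>f. f xs) fs"
      using Q that by auto
    then show ?thesis
      using Q that p[of "map (\<lambda>f. f xs) fs"] by (auto simp del: map_map)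
  qed
  then show ?thesis
    unfolding computable_fun_def by blast
qed

lemma computable_fun_zero: "computable_fun k (\<lambda>xs. 0)"
  unfolding computable_fun_def by (intro exI[of _ Zero]) auto

lemma computable_fun_Suc:
  assumes "computable_fun k f" shows "computable_fun k (\<lambda>xs. Suc (f xs))"
proof -
  have "computable_fun (Suc 0) (\<lambda>xs. Suc (xs ! 0))"
    unfolding computable_fun_def by (intro exI[of _ Succ]) (auto simp: length_Suc_conv)
  from computable_fun_compose[of "[f]", simplified, OF this assms] show ?thesis
    by simp
qed

lemma computable_fun_const: "computable_fun k (\<lambda>xs. c)"
  by (induction c) (auto intro: computable_fun_zero computable_fun_Suc)

lemma computable_fun_rec_nat:
  assumes f: "computable_fun k f" and g: "computable_fun (Suc (Suc k)) g"
    and n: "computable_fun k n"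
  shows "computable_fun k (\<lambda>xs. rec_nat (f xs) (\<lambda>m r. g (m # r # xs)) (n xs))"
proof -
  obtain p q where p: "\<And>xs. length xs = k \<Longrightarrow> run p xs = Some (f xs)"
    and q: "\<And>xs. length xs = Suc (Suc k) \<Longrightarrow> run q xs = Some (g xs)"
    using f g unfolding computable_fun_def by blast
  have r: "run (PrimRec p q) (m # xs) = Some (rec_nat (f xs) (\<lambda>m r. g (m # r # xs)) m)"
    if "length xs = k" for m xs
    using that by (induction m) (auto simp: p q)
  have "computable_fun (Suc k) (\<lambda>ys. rec_nat (f (tl ys)) (\<lambda>m r. g (m # r # tl ys)) (hd ys))"
    unfolding computable_fun_def
    by (intro exI[of _ "PrimRec p q"]) (auto simp: length_Suc_conv r simp del: run.simps)
  \<comment> \<open>\<open>PrimRec\<close> takes the counter as its first argument, so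
    \<open>n\<close> is prepended to the projections, which reproduce the parameters.\<close>
  then have *: "computable_fun k (\<lambda>xs. rec_nat (f (tl (map (\<lambda>f. f xs) (n # map (\<lambda>i xs. xs ! i) [0..<k]))))
     (\<lambda>m r. g (m # r # tl (map (\<lambda>f. f xs) (n # map (\<lambda>i xs. xs ! i) [0..<k]))))
     (hd (map (\<lambda>f. f xs) (n # map (\<lambda>i xs. xs ! i) [0..<k]))))"
    using n by (intro computable_fun_compose) (auto intro: computable_fun_nth)
  have "map (\<lambda>i. xs ! i) [0..<k] = xs" if "length xs = k" for xs :: "nat list"
    using that map_nth by blast
  then show ?thesis
    using * unfolding computable_fun_def by (simp add: comp_def)
qed

lemma computable_fun_add:
  assumes "computable_fun k f" "computable_fun k g"
  shows "computable_fun k (\<lambda>xs. f xs + g xs)"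
proof -
  have "rec_nat b (\<lambda>m r. Suc r) a = a + b" for a b
    by (induction a) auto
  then show ?thesis
    using computable_fun_rec_nat[OF assms(2) computable_fun_Suc[OF computable_fun_nth[of 1]] assms(1)]
    by simp
qed

lemma computable_fun_diff:
  assumes "computable_fun k f" "computable_fun k g"
  shows "computable_fun k (\<lambda>xs. f xs - g xs)"
proof -
  \<comment> \<open>Predecessor: the recursion hands back its counter, which ends one below
    \<open>a\<close>.\<close>
  have "rec_nat 0 (\<lambda>m r. m) a = a - 1" for a :: nat
    by (cases a) auto
  then have "computable_fun (Suc (Suc k)) (\<lambda>xs. xs ! 1 - 1)"
    using computable_fun_rec_nat[OF computable_fun_zero computable_fun_nth[of 0] computable_fun_nth[of 1 "Suc (Suc k)"]]
    by simp
  moreover have "rec_nat a (\<lambda>m r. r - 1) b = a - b" for a b :: nat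
    by (induction b) auto
  ultimately show ?thesis
    using computable_fun_rec_nat[OF assms(1) _ assms(2), of "\<lambda>xs. xs ! 1 - 1"]
    by simp
qed

section \<open>Triangular numbers and the pairing function\<close>

lemma computable_fun_triangle:
  assumes "computable_fun k f" shows "computable_fun k (\<lambda>xs. triangle (f xs))"
proof -
  have "rec_nat 0 (\<lambda>m r. r + Suc m) n = triangle n" for n
    by (induction n) auto
  then show ?thesis
    using computable_fun_rec_nat[OF computable_fun_zero
        computable_fun_add[OF computable_fun_nth[of 1] computable_fun_Suc[OF computable_fun_nth[of 0]]] assms]
    by simp
qed

lemma computable_fun_prod_encode:
  assumes "computable_fun k f" "computable_fun k g"
  shows "computable_fun k (\<lambda>xs. prod_encode (f xs, g xs))"
  unfolding prod_encode_def by (auto intro!: computable_fun_add computable_fun_triangle assms)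

text \<open>The largest \<open>r\<close> with \<open>triangle r \<le> n\<close>, found without
  search: by truncated subtraction the increment is 1 exactly when the counter \<open>Suc m\<close>
  has reached the next triangular number.\<close>

definition triangle_root :: "nat \<Rightarrow> nat" where
  "triangle_root n = rec_nat 0 (\<lambda>m r. r + (1 - (triangle (Suc r) - Suc m))) n"

lemma triangle_root_bounds:
  "triangle (triangle_root n) \<le> n \<and> n < triangle (Suc (triangle_root n))"
proof (induction n)
  case (Suc n)
  let ?r = "triangle_root n"
  have step: "triangle_root (Suc n) = ?r + (1 - (triangle (Suc ?r) - Suc n))"
    by (simp add: triangle_root_def)
  show ?case
  proof (cases "triangle (Suc ?r) = Suc n")
    case True
    then show ?thesis using step by simp
  next
    case False
    then have "triangle_root (Suc n) = ?r" using step Suc by simp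
    then show ?thesis using Suc False by simp
  qed
qed (simp add: triangle_root_def)

text \<open>\<open>prod_encode (a, b)\<close> is \<open>triangle (a + b) + a\<close>, where
  \<open>a\<close> is too small to reach the next triangular number; so the root is
  \<open>a + b\<close> and the remainder is \<open>a\<close>.\<close>

lemma prod_decode_triangle_root:
  "prod_decode n =
    (n - triangle (triangle_root n), triangle_root n - (n - triangle (triangle_root n)))"
proof -
  have "prod_encode (n - triangle (triangle_root n), triangle_root n - (n - triangle (triangle_root n))) = n"
    using triangle_root_bounds[of n] by (auto simp: prod_encode_def)
  then show ?thesis
    by (metis prod_encode_inverse)
qed

lemma computable_fun_triangle_root:
  assumes "computable_fun k f" shows "computable_fun k (\<lambda>xs. triangle_root (f xs))"
proof -
  have "computable_fun (Suc (Suc k))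
    (\<lambda>ys. ys ! 1 + (1 - (triangle (Suc (ys ! 1)) - Suc (ys ! 0))))"
    by (intro computable_fun_add computable_fun_diff computable_fun_triangle computable_fun_Suc
        computable_fun_nth computable_fun_const) auto
  from computable_fun_rec_nat[OF computable_fun_zero this assms] show ?thesis
    by (simp add: triangle_root_def)
qed

text \<open>One argument is enough once tuples are coded, and all closure rules then have the same
  shape, an abstraction over \<open>e\<close>; a bound variable is adjoined by pairing it with
  \<open>e\<close>.\<close>

definition computable :: "(nat \<Rightarrow> nat) \<Rightarrow> bool" where
  "computable f \<longleftrightarrow> computable_fun 1 (\<lambda>xs. f (xs ! 0))"

lemma computable_id: "computable (\<lambda>e. e)"
  unfolding computable_def by (simp add: computable_fun_nth)

lemma computable_const: "computable (\<lambda>e. c)"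
  unfolding computable_def by (rule computable_fun_const)

lemma computable_fun_apply:
  assumes "computable f" "computable_fun k g" shows "computable_fun k (\<lambda>xs. f (g xs))"
  using computable_fun_compose[of "[g]" "\<lambda>xs. f (xs ! 0)" k] assms by (simp add: computable_def)

lemma computable_compose: "computable f \<Longrightarrow> computable g \<Longrightarrow> computable (\<lambda>e. f (g e))"
  using computable_fun_apply[of f 1 "\<lambda>xs. g (xs ! 0)"] by (simp add: computable_def)

lemma computable_Suc: "computable f \<Longrightarrow> computable (\<lambda>e. Suc (f e))"
  unfolding computable_def by (rule computable_fun_Suc)

lemma computable_add: "computable f \<Longrightarrow> computable g \<Longrightarrow> computable (\<lambda>e. f e + g e)"
  unfolding computable_def by (rule computable_fun_add)

lemma computable_diff: "computable f \<Longrightarrow> computable g \<Longrightarrow> computable (\<lambda>e. f e - g e)"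
  unfolding computable_def by (rule computable_fun_diff)

lemma computable_prod_encode:
  "computable f \<Longrightarrow> computable g \<Longrightarrow> computable (\<lambda>e. prod_encode (f e, g e))"
  unfolding computable_def by (rule computable_fun_prod_encode)

lemma computable_fst: "computable f \<Longrightarrow> computable (\<lambda>e. fst (prod_decode (f e)))"
  unfolding computable_def prod_decode_triangle_root fst_conv
  by (intro computable_fun_diff computable_fun_triangle computable_fun_triangle_root)

lemma computable_snd: "computable f \<Longrightarrow> computable (\<lambda>e. snd (prod_decode (f e)))"
  unfolding computable_def prod_decode_triangle_root snd_conv
  by (intro computable_fun_diff computable_fun_triangle computable_fun_triangle_root)

lemma computable_rec_nat:
  assumes f: "computable f"
    and g: "computable (\<lambda>e. g (fst (prod_decode e)) (fst (prod_decode (snd (prod_decode e))))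
      (snd (prod_decode (snd (prod_decode e)))))" (is "computable ?g")
    and n: "computable n"
  shows "computable (\<lambda>e. rec_nat (f e) (\<lambda>m r. g m r e) (n e))"
proof -
  have "computable_fun (Suc (Suc 1)) (\<lambda>ys. ?g (prod_encode (ys ! 0, prod_encode (ys ! 1, ys ! 2))))"
    by (intro computable_fun_apply[OF g] computable_fun_prod_encode computable_fun_nth) auto
  then show ?thesis
    using computable_fun_rec_nat[OF f[unfolded computable_def] _ n[unfolded computable_def]]
    unfolding computable_def by fastforce
qed

lemmas computable_intros =
  computable_id computable_const computable_Suc computable_add computable_diff
  computable_prod_encode computable_fst computable_snd

lemma computable_mult:
  assumes "computable f" "computable g" shows "computable (\<lambda>e. f e * g e)"
proof -
  have "rec_nat 0 (\<lambda>m r. r + b) a = a * b" for a b :: nat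
    by (induction a) auto
  moreover have "computable (\<lambda>e. rec_nat 0 (\<lambda>m r. r + g e) (f e))"
    by (intro computable_rec_nat computable_intros computable_compose[OF assms(2)] assms)
  ultimately show ?thesis by simp
qed

text \<open>A sum of natural numbers vanishes iff all its terms do, so bounded sums later act as
  bounded universal quantifiers; with terms 0 and 1 they count.\<close>

lemma computable_sum:
  assumes "computable (\<lambda>e. f (fst (prod_decode e)) (snd (prod_decode e)))" (is "computable ?f")
    and "computable n"
  shows "computable (\<lambda>e. \<Sum>i<n e. f i e)"
proof -
  have "rec_nat 0 (\<lambda>m r. r + f m e) a = (\<Sum>i<a. f i e)" for a e
    by (induction a) auto
  moreover have "computable (\<lambda>e. rec_nat 0 (\<lambda>m r. r + ?f (prod_encode (m, e))) (n e))"
    by (intro computable_rec_nat computable_intros computable_compose[OF assms(1)] assms)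
  ultimately show ?thesis by simp
qed

section \<open>Coded lists\<close>

lemma computable_drop:
  assumes "computable f" "computable g"
  shows "computable (\<lambda>e. list_encode (drop (g e) (list_decode (f e))))"
proof -
  \<comment> \<open>The code of a nonempty list is the successor of a pair. The empty list has code
    0, where \<open>0 - 1 = 0\<close> decodes to \<open>(0, 0)\<close>, in accordance with
    \<open>tl [] = []\<close>.\<close>
  have tl: "list_encode (tl (list_decode n)) = snd (prod_decode (n - 1))" for n
    using prod_encode_inverse[of "(0, 0)"] by (cases n) (auto simp: prod_encode_def split: prod.split)
  have "rec_nat n (\<lambda>m r. snd (prod_decode (r - 1))) i = list_encode (drop i (list_decode n))" for n i
  proof (induction i)
    case (Suc i)
    then show ?case
      using tl[of "list_encode (drop i (list_decode n))"] by (simp add: drop_Suc tl_drop)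
  qed simp
  moreover have "computable (\<lambda>e. rec_nat (f e) (\<lambda>m r. snd (prod_decode (r - 1))) (g e))"
    by (intro computable_rec_nat computable_intros assms)
  ultimately show ?thesis by simp
qed

text \<open>Total, unlike \<open>list_decode l ! i\<close>, whose value is unspecified beyond the end of the list.\<close>

definition nth_code :: "nat \<Rightarrow> nat \<Rightarrow> nat" where
  "nth_code l i = fst (prod_decode (list_encode (drop i (list_decode l)) - 1))"

lemma nth_code_eq: "i < length (list_decode l) \<Longrightarrow> nth_code l i = list_decode l ! i"
  by (simp add: nth_code_def Cons_nth_drop_Suc[symmetric])

lemma computable_nth_code:
  "computable f \<Longrightarrow> computable g \<Longrightarrow> computable (\<lambda>e. nth_code (f e) (g e))"
  unfolding nth_code_def by (intro computable_intros computable_drop)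

text \<open>Makes the code itself an upper limit for the sum that counts the entries.\<close>

lemma length_list_decode_le: "length (list_decode n) \<le> n"
proof (induction n rule: less_induct)
  case (less n)
  show ?case
  proof (cases n)
    case (Suc m)
    obtain a b where ab: "prod_decode m = (a, b)" by fastforce
    then have "b \<le> m" by (metis le_prod_encode_2 prod_decode_inverse)
    then show ?thesis using less[of b] ab Suc by simp
  qed simp
qed

lemma computable_length:
  assumes "computable f" shows "computable (\<lambda>e. length (list_decode (f e)))"
proof -
  have z: "list_encode xs = 0 \<longleftrightarrow> xs = []" for xs
    by (cases xs) auto
  \<comment> \<open>\<open>1 - (1 - z)\<close> is the sign of \<open>z\<close>, and what remains
    after dropping \<open>i\<close> entries has a nonzero code iff \<open>i\<close> is below the
    length.\<close>
  have "(\<Sum>i<n. 1 - (1 - list_encode (drop i (list_decode n)))) = length (list_decode n)" for n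
  proof -
    have "(\<Sum>i<n. 1 - (1 - list_encode (drop i (list_decode n)))) =
        (\<Sum>i<n. if i < length (list_decode n) then 1 else 0)"
    proof (rule sum.cong)
      fix i show "1 - (1 - list_encode (drop i (list_decode n))) =
          (if i < length (list_decode n) then 1 else 0)"
        using z[of "drop i (list_decode n)"]
        by (cases "list_encode (drop i (list_decode n))") auto
    qed simp
    also have "\<dots> = card ({..<n} \<inter> {i. i < length (list_decode n)})"
      by (simp add: sum.If_cases)
    also have "{..<n} \<inter> {i. i < length (list_decode n)} = {..<length (list_decode n)}"
      using length_list_decode_le[of n] by auto
    finally show ?thesis by simp
  qed
  moreover have "computable (\<lambda>e. \<Sum>i<f e. 1 - (1 - list_encode (drop i (list_decode (f e)))))"
    by (intro computable_sum computable_intros computable_drop computable_compose[OF assms] assms)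
  ultimately show ?thesis by simp
qed

section \<open>Semidecidable predicates\<close>

text \<open>Projection of the zero set of a total function, instead of the domain of a partial one:
  the test of a single witness always halts, so unrelated searches can proceed together.\<close>

definition semidecidable :: "(nat \<Rightarrow> bool) \<Rightarrow> bool" where
  "semidecidable P \<longleftrightarrow> (\<exists>f. computable f \<and> (\<forall>e. P e \<longleftrightarrow> (\<exists>w. f (prod_encode (w, e)) = 0)))"

lemma semidecidableI:
  assumes "computable (\<lambda>n. f (fst (prod_decode n)) (snd (prod_decode n)))"
    and "\<And>e. P e \<longleftrightarrow> (\<exists>w. f w e = 0)"
  shows "semidecidable P"
  unfolding semidecidable_def using assms
  by (intro exI[of _ "\<lambda>n. f (fst (prod_decode n)) (snd (prod_decode n))"]) auto

lemma semidecidable_compose: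
  assumes "semidecidable P" "computable g" shows "semidecidable (\<lambda>e. P (g e))"
proof -
  obtain f where f: "computable f" "\<And>e. P e \<longleftrightarrow> (\<exists>w. f (prod_encode (w, e)) = 0)"
    using assms unfolding semidecidable_def by blast
  show ?thesis
    by (rule semidecidableI[of "\<lambda>w e. f (prod_encode (w, g e))"])
      (auto intro!: computable_compose[OF f(1)] computable_compose[OF assms(2)] computable_intros simp: f(2))
qed

lemma semidecidable_eq:
  assumes "computable f" "computable g" shows "semidecidable (\<lambda>e. f e = g e)"
  by (rule semidecidableI[of "\<lambda>w e. (f e - g e) + (g e - f e)"])
    (auto intro!: computable_compose[OF assms(1)] computable_compose[OF assms(2)] computable_intros)

lemma semidecidable_less:
  assumes "computable f" "computable g" shows "semidecidable (\<lambda>e. f e < g e)"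
  by (rule semidecidableI[of "\<lambda>w e. Suc (f e) - g e"])
    (auto intro!: computable_compose[OF assms(1)] computable_compose[OF assms(2)] computable_intros)

lemma semidecidable_conj:
  assumes "semidecidable P" "semidecidable Q" shows "semidecidable (\<lambda>e. P e \<and> Q e)"
proof -
  obtain f g where f: "computable f" "\<And>e. P e \<longleftrightarrow> (\<exists>w. f (prod_encode (w, e)) = 0)"
    and g: "computable g" "\<And>e. Q e \<longleftrightarrow> (\<exists>w. g (prod_encode (w, e)) = 0)"
    using assms unfolding semidecidable_def by metis
  let ?h = "\<lambda>w e. f (prod_encode (fst (prod_decode w), e)) + g (prod_encode (snd (prod_decode w), e))"
  show ?thesis
  proof (rule semidecidableI[of ?h])
    fix e
    have "\<exists>w. ?h w e = 0" if "f (prod_encode (a, e)) = 0" "g (prod_encode (b, e)) = 0" for a b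
      using that by (intro exI[of _ "prod_encode (a, b)"]) simp
    then show "P e \<and> Q e \<longleftrightarrow> (\<exists>w. ?h w e = 0)"
      using f(2) g(2) by auto
  qed (intro computable_intros computable_compose[OF f(1)] computable_compose[OF g(1)])
qed

text \<open>The same \<open>w\<close> is offered to both factors, and the product vanishes as soon
  as one of them does.\<close>

lemma semidecidable_disj:
  assumes "semidecidable P" "semidecidable Q" shows "semidecidable (\<lambda>e. P e \<or> Q e)"
proof -
  obtain f g where f: "computable f" "\<And>e. P e \<longleftrightarrow> (\<exists>w. f (prod_encode (w, e)) = 0)"
    and g: "computable g" "\<And>e. Q e \<longleftrightarrow> (\<exists>w. g (prod_encode (w, e)) = 0)"
    using assms unfolding semidecidable_def by metis
  show ?thesis
    by (rule semidecidableI[of "\<lambda>w e. f (prod_encode (w, e)) * g (prod_encode (w, e))"])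
      (auto intro!: computable_intros computable_mult computable_compose[OF f(1)]
        computable_compose[OF g(1)] simp: f(2) g(2))
qed

lemma semidecidable_ex:
  assumes "semidecidable (\<lambda>e. P (fst (prod_decode e)) (snd (prod_decode e)))"
  shows "semidecidable (\<lambda>e. \<exists>x. P x e)"
proof -
  obtain f where f: "computable f"
    and P: "\<And>e. P (fst (prod_decode e)) (snd (prod_decode e)) \<longleftrightarrow> (\<exists>w. f (prod_encode (w, e)) = 0)"
    using assms unfolding semidecidable_def by auto
  let ?h = "\<lambda>w e. f (prod_encode (fst (prod_decode w), prod_encode (snd (prod_decode w), e)))"
  show ?thesis
  proof (rule semidecidableI[of ?h])
    fix e
    have P': "P x e \<longleftrightarrow> (\<exists>w. f (prod_encode (w, prod_encode (x, e))) = 0)" for x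
      using P[of "prod_encode (x, e)"] by simp
    have "\<exists>w. ?h w e = 0" if "f (prod_encode (w, prod_encode (x, e))) = 0" for w x
      using that by (intro exI[of _ "prod_encode (w, x)"]) simp
    then show "(\<exists>x. P x e) \<longleftrightarrow> (\<exists>w. ?h w e = 0)"
      unfolding P' by blast
  qed (intro computable_intros computable_compose[OF f])
qed

text \<open>Finitely many instances need finitely many witnesses, which are collected in one coded
  list \<open>w\<close> and checked by a sum. Totality of \<open>nth_code\<close> keeps the test
  computable also for lists that are too short.\<close>

lemma semidecidable_all_less:
  assumes "semidecidable (\<lambda>e. P (fst (prod_decode e)) (snd (prod_decode e)))"
    and n: "computable n"
  shows "semidecidable (\<lambda>e. \<forall>i<n e. P i e)"
proof -
  obtain f where f: "computable f"
    and P: "\<And>e. P (fst (prod_decode e)) (snd (prod_decode e)) \<longleftrightarrow> (\<exists>w. f (prod_encode (w, e)) = 0)"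
    using assms unfolding semidecidable_def by auto
  let ?h = "\<lambda>w e. \<Sum>i<n e. f (prod_encode (nth_code w i, prod_encode (i, e)))"
  show ?thesis
  proof (rule semidecidableI[of ?h])
    fix e
    have P': "P x e \<longleftrightarrow> (\<exists>w. f (prod_encode (w, prod_encode (x, e))) = 0)" for x
      using P[of "prod_encode (x, e)"] by simp
    show "(\<forall>i<n e. P i e) \<longleftrightarrow> (\<exists>w. ?h w e = 0)"
    proof
      assume "\<forall>i<n e. P i e"
      then obtain w where "\<And>i. i < n e \<Longrightarrow> f (prod_encode (w i, prod_encode (i, e))) = 0"
        unfolding P' by metis
      then have "?h (list_encode (map w [0..<n e])) e = 0"
        by (simp add: nth_code_eq)
      then show "\<exists>w. ?h w e = 0" by blast
    qed (auto simp: P')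
  qed (intro computable_sum computable_intros computable_nth_code computable_compose[OF f]
      computable_compose[OF n])
qed

lemma semidecidable_mem_list:
  assumes "computable f" "computable g"
  shows "semidecidable (\<lambda>e. f e \<in> set (list_decode (g e)))"
proof -
  have "a \<in> set (list_decode l) \<longleftrightarrow> (\<exists>i. i < length (list_decode l) \<and> nth_code l i = a)" for a l
    by (auto simp: in_set_conv_nth nth_code_eq)
  moreover have "semidecidable (\<lambda>e. \<exists>i. i < length (list_decode (g e)) \<and> nth_code (g e) i = f e)"
    by (intro semidecidable_ex semidecidable_conj semidecidable_less semidecidable_eq computable_intros
        computable_length computable_nth_code computable_compose[OF assms(1)] computable_compose[OF assms(2)])
  ultimately show ?thesis by simp
qed

lemmas semidecidable_intros =
  semidecidable_eq semidecidable_less semidecidable_conj semidecidable_disj semidecidable_ex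
  semidecidable_all_less semidecidable_mem_list computable_length computable_nth_code computable_intros

text \<open>A common search for a zero of the product of \<open>f\<close> and \<open>g\<close> halts
  wherever one of the predicates holds. Where exactly one holds, the factor that vanishes tells
  which.\<close>

lemma decide_complementary:
  assumes "semidecidable P" "semidecidable Q"
  obtains A where "\<And>a b. P (prod_encode (a, b)) \<noteq> Q (prod_encode (a, b)) \<Longrightarrow>
    run A [a, b] = Some (if P (prod_encode (a, b)) then 1 else 0)"
proof -
  obtain f g where f: "computable f" "\<And>e. P e \<longleftrightarrow> (\<exists>w. f (prod_encode (w, e)) = 0)"
    and g: "computable g" "\<And>e. Q e \<longleftrightarrow> (\<exists>w. g (prod_encode (w, e)) = 0)"
    using assms unfolding semidecidable_def by metis
  have run3: "\<exists>p. \<forall>w a b. run p [w, a, b] = Some (h (prod_encode (w, prod_encode (a, b))))"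
    if h: "computable h" for h
  proof -
    have "computable_fun 3 (\<lambda>xs. h (prod_encode (xs ! 0, prod_encode (xs ! 1, xs ! 2))))"
      by (intro computable_fun_apply[OF h] computable_fun_prod_encode computable_fun_nth) auto
    then obtain p where "\<And>xs. length xs = 3 \<Longrightarrow>
        run p xs = Some (h (prod_encode (xs ! 0, prod_encode (xs ! 1, xs ! 2))))"
      unfolding computable_fun_def by blast
    from this[of "[_, _, _]"] show ?thesis by (intro exI[of _ p]) simp
  qed
  obtain p where p: "\<And>w a b. run p [w, a, b] =
      Some (f (prod_encode (w, prod_encode (a, b))) * g (prod_encode (w, prod_encode (a, b))))"
    using run3[OF computable_mult[OF f(1) g(1)]] by blast
  obtain q where q: "\<And>w a b. run q [w, a, b] = Some (1 - f (prod_encode (w, prod_encode (a, b))))"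
    using run3[OF computable_diff[OF computable_const f(1)]] by blast
  \<comment> \<open>\<open>q\<close> reevaluates \<open>f\<close> at the witness found by
    \<open>Mu p\<close>: the output is 1 if \<open>f\<close> vanishes there, and 0 otherwise, in
    which case \<open>g\<close> vanishes and \<open>Q\<close> holds.\<close>
  show thesis
  proof (rule that[of "Comp q [Mu p, Proj 0, Proj 1]"])
    fix a b assume PQ: "P (prod_encode (a, b)) \<noteq> Q (prod_encode (a, b))"
    define Z where "Z w \<longleftrightarrow> f (prod_encode (w, prod_encode (a, b))) = 0 \<or>
      g (prod_encode (w, prod_encode (a, b))) = 0" for w
    have "\<exists>w. Z w" using PQ f(2) g(2) unfolding Z_def by auto
    then have "Z (Least Z)" by (rule LeastI_ex)
    moreover have "run (Mu p) [a, b] = Some (Least Z)"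
      using \<open>\<exists>w. Z w\<close> by (simp add: p Z_def[abs_def])
    moreover have "f (prod_encode (Least Z, prod_encode (a, b))) = 0 \<longleftrightarrow> P (prod_encode (a, b))"
      using \<open>Z (Least Z)\<close> PQ f(2) g(2) unfolding Z_def by blast
    ultimately show "run (Comp q [Mu p, Proj 0, Proj 1]) [a, b] =
        Some (if P (prod_encode (a, b)) then 1 else 0)"
      by (auto simp del: run.simps(8) simp: q)
  qed
qed

section \<open>Finitary rule systems\<close>

inductive derivable :: "(nat set \<Rightarrow> nat \<Rightarrow> bool) \<Rightarrow> nat \<Rightarrow> bool" for S where
  derivableI: "finite A \<Longrightarrow> (\<And>a. a \<in> A \<Longrightarrow> derivable S a) \<Longrightarrow> S A c \<Longrightarrow> derivable S c"

text \<open>A derivation is a list in which every member follows in one step from later members.\<close>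

lemma derivable_iff_derivation:
  assumes mono: "\<And>A B c. A \<subseteq> B \<Longrightarrow> S A c \<Longrightarrow> S B c"
  shows "derivable S c \<longleftrightarrow>
    (\<exists>l. c \<in> set l \<and> (\<forall>i<length l. S (set (drop (Suc i) l)) (l ! i)))"
proof -
  define V where "V l \<longleftrightarrow> (\<forall>i<length l. S (set (drop (Suc i) l)) (l ! i))" for l
  have Cons: "V (c # l) \<longleftrightarrow> S (set l) c \<and> V l" for c l
    unfolding V_def by (simp add: All_less_Suc2)
  \<comment> \<open>Later entries remain later after appending; the premises available to the
    entries of \<open>l\<close> only gain members, which \<open>mono\<close> allows.\<close>
  have app: "V l \<Longrightarrow> V l' \<Longrightarrow> V (l @ l')" for l l'
    by (induction l) (auto simp: Cons intro: mono[rotated])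
  \<comment> \<open>Derivations of finitely many premises are concatenated; this is where finiteness
    of \<open>A\<close> enters.\<close>
  have conc: "\<exists>l. V l \<and> A \<subseteq> set l" if "finite A" "\<And>a. a \<in> A \<Longrightarrow> \<exists>l. a \<in> set l \<and> V l" for A
    using that
  proof (induction A rule: finite_induct)
    case empty
    show ?case by (rule exI[of _ "[]"]) (simp add: V_def)
  next
    case (insert a A)
    then obtain l l' where "V l" "A \<subseteq> set l" "a \<in> set l'" "V l'" by (metis insertCI)
    then show ?case using app by (intro exI[of _ "l @ l'"]) auto
  qed
  have "\<exists>l. c \<in> set l \<and> V l" if "derivable S c"
    using that
  proof induction
    case (derivableI A c)
    then obtain l where "V l" "A \<subseteq> set l" using conc by metis
    then show ?case using derivableI mono Cons by (metis list.set_intros(1))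
  qed
  moreover have "\<forall>c\<in>set l. derivable S c" if "V l" for l
    using that
    by (induction l) (auto simp: Cons intro: derivable.derivableI[of "set _"])
  ultimately show ?thesis unfolding V_def[symmetric] by blast
qed

text \<open>The witness is the code of a derivation, whose entries are checked by a bounded
  quantifier. The rules may depend on the input through \<open>e\<close>, which gives one search for
  all presentations.\<close>

lemma semidecidable_derivable:
  assumes S: "semidecidable (\<lambda>e. S (fst (prod_decode e))
      (set (list_decode (fst (prod_decode (snd (prod_decode e))))))
      (snd (prod_decode (snd (prod_decode e)))))" (is "semidecidable ?S")
    and mono: "\<And>e A B c. A \<subseteq> B \<Longrightarrow> S e A c \<Longrightarrow> S e B c"
    and f: "computable f" and g: "computable g"
  shows "semidecidable (\<lambda>e. derivable (S (f e)) (g e))"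
proof -
  have *: "derivable (S e) c \<longleftrightarrow> (\<exists>l. c \<in> set (list_decode l) \<and> (\<forall>i<length (list_decode l).
      ?S (prod_encode (e, prod_encode (list_encode (drop (Suc i) (list_decode l)), nth_code l i)))))"
    for e c
  proof -
    have "(\<exists>l. Q l) \<longleftrightarrow> (\<exists>l. Q (list_decode l))" for Q
      by (metis list_encode_inverse)
    note this[of "\<lambda>l. c \<in> set l \<and> (\<forall>i<length l. S e (set (drop (Suc i) l)) (l ! i))"]
    moreover have "derivable (S e) c \<longleftrightarrow>
        (\<exists>l. c \<in> set l \<and> (\<forall>i<length l. S e (set (drop (Suc i) l)) (l ! i)))"
      by (rule derivable_iff_derivation) (rule mono)
    ultimately show ?thesis by (simp add: nth_code_eq)
  qed
  show ?thesis
    unfolding * by (intro semidecidable_compose[OF S] semidecidable_intros computable_drop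
        computable_compose[OF f] computable_compose[OF g])
qed

section \<open>Runs of programs\<close>

text \<open>Facts are coded triples of a program, its arguments and its output.\<close>

abbreviation run_fact :: "nat \<Rightarrow> nat \<Rightarrow> nat \<Rightarrow> nat" where
  "run_fact p xs y \<equiv> prod_encode (p, prod_encode (xs, y))"

text \<open>\<open>Suc (prod_encode (x, xs))\<close> is the code of a list with head
  \<open>x\<close>. All conditions are positive: \<open>Mu\<close> asks for a successor value at
  each smaller argument, which expresses both that the run halts there and that its value is not
  zero. Hence the rules are monotone and semidecidable.\<close>

definition run_step :: "nat set \<Rightarrow> nat \<Rightarrow> bool" where
  "run_step A c \<longleftrightarrow>
    (\<exists>xs. c = run_fact (prod_encode (0, 0)) xs 0) \<or>
    (\<exists>x xs. c = run_fact (prod_encode (1, 0)) (Suc (prod_encode (x, xs))) (Suc x)) \<or>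
    (\<exists>i xs. i < length (list_decode xs) \<and> c = run_fact (prod_encode (2, i)) xs (nth_code xs i)) \<or>
    (\<exists>p qs xs ys y. c = run_fact (prod_encode (3, prod_encode (p, qs))) xs y \<and> run_fact p ys y \<in> A \<and>
      length (list_decode ys) = length (list_decode qs) \<and>
      (\<forall>j<length (list_decode qs). run_fact (nth_code qs j) xs (nth_code ys j) \<in> A)) \<or>
    (\<exists>p q xs y. c = run_fact (prod_encode (4, prod_encode (p, q))) (Suc (prod_encode (0, xs))) y \<and>
      run_fact p xs y \<in> A) \<or>
    (\<exists>p q n xs r y. c = run_fact (prod_encode (4, prod_encode (p, q))) (Suc (prod_encode (Suc n, xs))) y \<and>
      run_fact (prod_encode (4, prod_encode (p, q))) (Suc (prod_encode (n, xs))) r \<in> A \<and>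
      run_fact q (Suc (prod_encode (n, Suc (prod_encode (r, xs))))) y \<in> A) \<or>
    (\<exists>p xs n. c = run_fact (prod_encode (5, p)) xs n \<and>
      run_fact p (Suc (prod_encode (n, xs))) 0 \<in> A \<and>
      (\<forall>m<n. \<exists>y. run_fact p (Suc (prod_encode (m, xs))) (Suc y) \<in> A))"

lemma run_step_mono: "A \<subseteq> B \<Longrightarrow> run_step A c \<Longrightarrow> run_step B c"
  unfolding run_step_def
  by (elim disj_forward ex_forward conj_forward all_forward imp_forward;
      (assumption | erule (1) subsetD))

lemma run_step_simps:
  "run_step A (run_fact (prod_encode (0, 0)) xs y) \<longleftrightarrow> y = 0"
  "run_step A (run_fact (prod_encode (Suc 0, 0)) xs y) \<longleftrightarrow>
    (\<exists>x l. xs = Suc (prod_encode (x, l)) \<and> y = Suc x)"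
  "run_step A (run_fact (prod_encode (2, i)) xs y) \<longleftrightarrow>
    i < length (list_decode xs) \<and> y = nth_code xs i"
  "run_step A (run_fact (prod_encode (3, prod_encode (p, qs))) xs y) \<longleftrightarrow>
    (\<exists>ys. run_fact p ys y \<in> A \<and> length (list_decode ys) = length (list_decode qs) \<and>
      (\<forall>j<length (list_decode qs). run_fact (nth_code qs j) xs (nth_code ys j) \<in> A))"
  "run_step A (run_fact (prod_encode (4, prod_encode (p, q))) xs y) \<longleftrightarrow>
    (\<exists>l. xs = Suc (prod_encode (0, l)) \<and> run_fact p l y \<in> A) \<or>
    (\<exists>n l r. xs = Suc (prod_encode (Suc n, l)) \<and>
      run_fact (prod_encode (4, prod_encode (p, q))) (Suc (prod_encode (n, l))) r \<in> A \<and>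
      run_fact q (Suc (prod_encode (n, Suc (prod_encode (r, l))))) y \<in> A)"
  "run_step A (run_fact (prod_encode (5, p)) xs y) \<longleftrightarrow>
    run_fact p (Suc (prod_encode (y, xs))) 0 \<in> A \<and>
    (\<forall>m<y. \<exists>z. run_fact p (Suc (prod_encode (m, xs))) (Suc z) \<in> A)"
  by (auto simp: run_step_def)

lemma semidecidable_derivable_run_step:
  assumes "computable g" shows "semidecidable (\<lambda>e. derivable run_step (g e))"
  using computable_const[of 0] assms
  by (intro semidecidable_derivable[where S = "\<lambda>_. run_step" and f = "\<lambda>_. 0", OF _ run_step_mono])
    (unfold run_step_def, intro semidecidable_intros)

text \<open>Induction over the derivation: a \<open>PrimRec\<close> fact may rest on a fact about
  the same program with a smaller counter, so structural induction over programs alone would not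
  reach it.\<close>

lemma derivable_run_step_sound:
  "derivable run_step c \<Longrightarrow> c = run_fact (code_program p) (list_encode xs) y \<Longrightarrow> run p xs = Some y"
proof (induction arbitrary: p xs y rule: derivable.induct)
  case (derivableI A c)
  have IH: "run q zs = Some z" if "run_fact (code_program q) (list_encode zs) z \<in> A" for q zs z
    using derivableI.IH that by blast
  have cons: "xs = a # list_decode l" if "list_encode xs = Suc (prod_encode (a, l))" for a l
    using arg_cong[OF that, of list_decode] by simp
  have step: "run_step A (run_fact (code_program p) (list_encode xs) y)"
    using derivableI by simp
  show ?case
  proof (cases p)
    case Zero
    then show ?thesis using step by (auto simp: run_step_simps)
  next
    case Succ
    then show ?thesis using step by (auto simp: run_step_simps dest: cons)
  next
    case (Proj i)
    then show ?thesis using step by (auto simp: run_step_simps nth_code_eq)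
  next
    case (Comp p' qs)
    then obtain ys where ys: "run_fact (code_program p') ys y \<in> A" "length (list_decode ys) = length qs"
      and qs: "\<And>j. j < length qs \<Longrightarrow>
        run_fact (nth_code (list_encode (map code_program qs)) j) (list_encode xs) (nth_code ys j) \<in> A"
      using step by (auto simp: run_step_simps)
    have run_qs: "run (qs ! j) xs = Some (list_decode ys ! j)" if "j < length qs" for j
      using qs[OF that] that ys(2) by (intro IH) (simp add: nth_code_eq)
    have "map (\<lambda>q. the (run q xs)) qs = list_decode ys"
      using run_qs ys(2) by (intro nth_equalityI) auto
    moreover have "run p' (list_decode ys) = Some y"
      using ys(1) by (intro IH) simp
    moreover have "\<forall>q\<in>set qs. run q xs \<noteq> None"
      using run_qs by (auto simp: in_set_conv_nth)
    ultimately show ?thesis using Comp by simp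
  next
    case (PrimRec p' q)
    then have "(\<exists>l. list_encode xs = Suc (prod_encode (0, l)) \<and> run_fact (code_program p') l y \<in> A) \<or>
      (\<exists>n l r. list_encode xs = Suc (prod_encode (Suc n, l)) \<and>
        run_fact (code_program p) (Suc (prod_encode (n, l))) r \<in> A \<and>
        run_fact (code_program q) (Suc (prod_encode (n, Suc (prod_encode (r, l))))) y \<in> A)"
      using step by (simp add: run_step_simps)
    then consider l where "list_encode xs = Suc (prod_encode (0, l))" "run_fact (code_program p') l y \<in> A"
      | n l r where "list_encode xs = Suc (prod_encode (Suc n, l))"
        "run_fact (code_program p) (Suc (prod_encode (n, l))) r \<in> A"
        "run_fact (code_program q) (Suc (prod_encode (n, Suc (prod_encode (r, l))))) y \<in> A"
      by blast
    then show ?thesis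
    proof cases
      case 1
      then have "xs = 0 # list_decode l" using cons by blast
      then show ?thesis using IH[of p' "list_decode l" y] 1 PrimRec by simp
    next
      case 2
      then have "xs = Suc n # list_decode l" using cons by blast
      moreover have "run p (n # list_decode l) = Some r"
        using 2 by (intro IH) simp
      moreover have "run q (n # r # list_decode l) = Some y"
        using 2 by (intro IH) simp
      ultimately show ?thesis using PrimRec by simp
    qed
  next
    case (Mu p')
    then have y: "run_fact (code_program p') (Suc (prod_encode (y, list_encode xs))) 0 \<in> A"
      and less: "\<And>m. m < y \<Longrightarrow> \<exists>z. run_fact (code_program p') (Suc (prod_encode (m, list_encode xs))) (Suc z) \<in> A"
      using step by (auto simp: run_step_simps)
    have "run p' (y # xs) = Some 0"
      using y by (intro IH) simp
    moreover have pos: "\<exists>z. run p' (m # xs) = Some (Suc z)" if m: "m < y" for m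
    proof -
      obtain z where "run_fact (code_program p') (Suc (prod_encode (m, list_encode xs))) (Suc z) \<in> A"
        using less[OF m] by blast
      then have "run p' (m # xs) = Some (Suc z)" by (intro IH) simp
      then show ?thesis by blast
    qed
    ultimately have "(LEAST n. run p' (n # xs) = Some 0) = y"
      by (intro Least_equality) (auto intro!: leI dest: pos)
    moreover have "\<exists>n. run p' (n # xs) = Some 0 \<and> (\<forall>m<n. run p' (m # xs) \<noteq> None)"
      using \<open>run p' (y # xs) = Some 0\<close> pos by (intro exI[of _ y]) auto
    ultimately show ?thesis using Mu by simp
  qed
qed

lemma derivable_empty: "S {} c \<Longrightarrow> derivable S c"
  by (rule derivable.derivableI[of "{}"]) auto

lemma derivable_insert2: "derivable S a \<Longrightarrow> derivable S b \<Longrightarrow> S {a, b} c \<Longrightarrow> derivable S c"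
  by (rule derivable.derivableI[of "{a, b}"]) auto

lemma derivable_run_step_complete:
  "run p xs = Some y \<Longrightarrow> derivable run_step (run_fact (code_program p) (list_encode xs) y)"
proof (induction p arbitrary: xs y)
  case Zero
  then show ?case
    by (intro derivable_empty) (simp add: run_step_simps)
next
  case Succ
  then show ?case
    by (cases xs) (auto intro!: derivable_empty simp: run_step_simps)
next
  case (Proj i)
  then show ?case
    by (auto intro!: derivable_empty simp: run_step_simps nth_code_eq split: if_splits)
next
  case (Comp p qs)
  define ys where "ys = map (\<lambda>q. the (run q xs)) qs"
  from Comp.prems have y: "run p ys = Some y" and qs: "\<And>q. q \<in> set qs \<Longrightarrow> run q xs \<noteq> None"
    by (auto simp: ys_def split: if_splits)
  define A where "A = insert (run_fact (code_program p) (list_encode ys) y)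
    ((\<lambda>q. run_fact (code_program q) (list_encode xs) (the (run q xs))) ` set qs)"
  have "derivable run_step a" if "a \<in> A" for a
    using that Comp.IH(1)[OF y] Comp.IH(2) qs unfolding A_def by auto
  moreover have "run_step A (run_fact (code_program (Comp p qs)) (list_encode xs) y)"
  proof -
    have "\<forall>j<length qs. run_fact (nth_code (list_encode (map code_program qs)) j) (list_encode xs)
        (nth_code (list_encode ys) j) \<in> A"
      by (auto simp: A_def ys_def nth_code_eq)
    moreover have "run_fact (code_program p) (list_encode ys) y \<in> A"
      by (simp add: A_def)
    moreover have "length ys = length qs" by (simp add: ys_def)
    ultimately show ?thesis by (auto simp: run_step_simps)
  qed
  moreover have "finite A" by (simp add: A_def)
  ultimately show ?case by (metis derivable.derivableI)
next
  case (PrimRec p q)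
  from PrimRec.prems obtain n zs where xs: "xs = n # zs" by (cases xs) auto
  \<comment> \<open>The inner induction over the counter supplies the fact about the previous value,
    which belongs to the same program.\<close>
  have "run (PrimRec p q) (n # zs) = Some y \<Longrightarrow>
      derivable run_step (run_fact (code_program (PrimRec p q)) (list_encode (n # zs)) y)" for n y
  proof (induction n arbitrary: y)
    case 0
    then have "run p zs = Some y" by simp
    note IH = PrimRec.IH(1)[OF this]
    show ?case
      by (rule derivable_insert2[OF IH IH]) (simp add: run_step_simps)
  next
    case (Suc n)
    then obtain r where r: "run (PrimRec p q) (n # zs) = Some r" "run q (n # r # zs) = Some y"
      by (auto split: option.splits)
    show ?case
      by (rule derivable_insert2[OF Suc.IH[OF r(1)] PrimRec.IH(2)[OF r(2)]])
        (auto simp: run_step_simps)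
  qed
  then show ?case using PrimRec.prems xs by simp
next
  case (Mu p)
  let ?f = "\<lambda>n z. run_fact (code_program p) (list_encode (n # xs)) z"
  from Mu.prems have ex: "\<exists>n. run p (n # xs) = Some 0 \<and> (\<forall>m<n. run p (m # xs) \<noteq> None)"
    and y: "y = (LEAST n. run p (n # xs) = Some 0)"
    by (auto split: if_splits)
  from ex have y0: "run p (y # xs) = Some 0"
    unfolding y by (metis (mono_tags, lifting) LeastI)
  have less: "\<exists>z. run p (m # xs) = Some (Suc z)" if "m < y" for m
  proof -
    from that have "run p (m # xs) \<noteq> Some 0" unfolding y by (rule not_less_Least)
    \<comment> \<open>The least zero is at most the zero supplied by \<open>ex\<close>, before which
      all runs halt.\<close>
    moreover have "run p (m # xs) \<noteq> None"
      using ex that unfolding y by (metis (mono_tags, lifting) Least_le order_less_le_trans)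
    ultimately show ?thesis by (metis not0_implies_Suc option.exhaust)
  qed
  then obtain z where z: "\<And>m. m < y \<Longrightarrow> run p (m # xs) = Some (Suc (z m))" by metis
  let ?A = "insert (?f y 0) ((\<lambda>m. ?f m (Suc (z m))) ` {..<y})"
  show ?case
  proof (rule derivableI[of ?A])
    show "derivable run_step a" if "a \<in> ?A" for a
      using that Mu.IH[OF y0] Mu.IH[OF z] by auto
    show "run_step ?A (run_fact (code_program (Mu p)) (list_encode xs) y)"
      by (auto simp: run_step_simps)
  qed simp
qed

lemma run_iff_derivable:
  "run p xs = Some y \<longleftrightarrow> derivable run_step (run_fact (code_program p) (list_encode xs) y)"
  using derivable_run_step_sound derivable_run_step_complete by blast

section \<open>Congruence of words\<close>

text \<open>Every rule acts at the front of a word and leaves an arbitrary tail; prefixes come from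
  \<open>Cons\<close>. So no word has to be split in the middle when the rules are transferred to
  codes. Letters outside the alphabet are tolerated, which spares the enumeration a check of
  well-formedness.\<close>

inductive word_cong :: "nat \<Rightarrow> word set \<Rightarrow> word \<Rightarrow> word \<Rightarrow> bool" for k R where
  refl: "word_cong k R u u"
| sym: "word_cong k R u v \<Longrightarrow> word_cong k R v u"
| trans: "word_cong k R u v \<Longrightarrow> word_cong k R v w \<Longrightarrow> word_cong k R u w"
| Cons: "word_cong k R u v \<Longrightarrow> word_cong k R (a # u) (a # v)"
| cancel: "a \<in> letters k \<Longrightarrow> word_cong k R (a # inv_letter a # u) u"
| rel: "r \<in> R \<Longrightarrow> word_cong k R (r @ u) u"

lemma words_Nil: "[] \<in> words k"
  by (simp add: words_def)

lemma words_append: "u @ v \<in> words k \<longleftrightarrow> u \<in> words k \<and> v \<in> words k"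
  by (auto simp: words_def)

lemma words_Cons: "a # v \<in> words k \<longleftrightarrow> a \<in> letters k \<and> v \<in> words k"
  by (auto simp: words_def)

lemma inv_letter_letters: "inv_letter a \<in> letters k \<longleftrightarrow> a \<in> letters k"
  by (cases a) (auto simp: letters_def)

lemma inv_letter_inv_letter: "inv_letter (inv_letter a) = a"
  by (cases a) auto

text \<open>The first factor is changed while \<open>v\<close> serves as tail in each rule, then the
  second under the prefix \<open>u'\<close> by \<open>Cons\<close>.\<close>

lemma word_cong_append:
  assumes "word_cong k R u u'" "word_cong k R v v'" shows "word_cong k R (u @ v) (u' @ v')"
proof -
  have "word_cong k R (u @ v) (u' @ v)"
    using assms(1) by induction (auto intro: word_cong.intros)
  moreover have "word_cong k R (u' @ v) (u' @ v')"
    using assms(2) by (induction u') (auto intro: word_cong.intros)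
  ultimately show ?thesis by (rule trans)
qed

text \<open>Words with foreign letters form classes of their own, so tolerating them does no
  harm.\<close>

lemma word_cong_words:
  "word_cong k R u v \<Longrightarrow> R \<subseteq> words k \<Longrightarrow> u \<in> words k \<longleftrightarrow> v \<in> words k"
  by (induction rule: word_cong.induct) (auto simp: words_append words_Cons inv_letter_letters)

lemma word_cong_mono: "word_cong k R u v \<Longrightarrow> R \<subseteq> R' \<Longrightarrow> word_cong k R' u v"
  by (induction rule: word_cong.induct) (auto intro: word_cong.intros)

text \<open>Serves two purposes: with the empty word as extra relator it recovers the congruence of
  \<open>R\<close> from a system that always has one relator added; with a word \<open>x\<close>
  that is already trivial it shows that adding \<open>x\<close> does not change the group.\<close>

lemma word_cong_drop_trivial_relator:
  "word_cong k (insert x R) u v \<Longrightarrow> word_cong k R x [] \<Longrightarrow> word_cong k R u v"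
proof (induction rule: word_cong.induct)
  case (rel r u)
  then show ?case using word_cong_append[of k R x "[]" u u] by (auto intro: word_cong.intros)
qed (auto intro: word_cong.intros)

definition inv_word :: "word \<Rightarrow> word" where
  "inv_word w = rev (map inv_letter w)"

lemma inv_word_words: "inv_word w \<in> words k \<longleftrightarrow> w \<in> words k"
  by (induction w) (auto simp: inv_word_def words_append words_Cons words_Nil inv_letter_letters)

lemma inv_word_inv_word: "inv_word (inv_word w) = w"
  by (simp add: inv_word_def rev_map comp_def inv_letter_inv_letter)

lemma word_cong_inv_word: "w \<in> words k \<Longrightarrow> word_cong k R (w @ inv_word w) []"
proof (induction w)
  case (Cons a w)
  then have w: "word_cong k R (w @ inv_word w) []" and a: "a \<in> letters k"
    by (auto simp: words_Cons)
  have "word_cong k R (a # (w @ inv_word w) @ [inv_letter a]) (a # [] @ [inv_letter a])"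
    by (intro word_cong.Cons word_cong_append[OF w] refl)
  moreover have "word_cong k R (a # [] @ [inv_letter a]) []"
    using cancel[OF a, of R "[]"] by simp
  ultimately show ?case using word_cong.trans by (fastforce simp: inv_word_def)
qed (simp add: inv_word_def refl)

lemma word_cong_inv_word': "w \<in> words k \<Longrightarrow> word_cong k R (inv_word w @ w) []"
  using word_cong_inv_word[of "inv_word w"] by (simp add: inv_word_words inv_word_inv_word)

section \<open>Free and presented groups\<close>

lemma free_eq_words: "(u, v) \<in> free_eq k \<Longrightarrow> u \<in> words k \<and> v \<in> words k"
  by (induction rule: free_eq.induct) (auto simp: words_append words_Cons words_Nil inv_letter_letters)

lemma equiv_free_eq: "equiv (words k) (free_eq k)"
  by (rule equivI)
    (auto intro!: refl_onI symI transI intro: free_eq.intros dest: free_eq_words)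

lemma free_eq_append_right:
  "(u, u') \<in> free_eq k \<Longrightarrow> v \<in> words k \<Longrightarrow> (u @ v, u' @ v) \<in> free_eq k"
proof (induction rule: free_eq.induct)
  case (cancel u w a)
  then show ?case using free_eq.cancel[of u k "w @ v" a] by (simp add: words_append)
qed (auto intro: free_eq.intros simp: words_append)

lemma free_eq_append_left:
  "(u, u') \<in> free_eq k \<Longrightarrow> v \<in> words k \<Longrightarrow> (v @ u, v @ u') \<in> free_eq k"
proof (induction rule: free_eq.induct)
  case (cancel u w a)
  then show ?case using free_eq.cancel[of "v @ u" k w a] by (simp add: words_append)
qed (auto intro: free_eq.intros simp: words_append)

lemma word_cong_free_eq: "(u, v) \<in> free_eq k \<Longrightarrow> word_cong k R u v"
proof (induction rule: free_eq.induct)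
  case (cancel u v a)
  then show ?case
    using word_cong_append[OF word_cong.refl[of k R u] word_cong.cancel[of a k R v]] by simp
qed (auto intro: word_cong.intros)

lemma free_class_eq_iff:
  "u \<in> words k \<Longrightarrow> v \<in> words k \<Longrightarrow> free_class k u = free_class k v \<longleftrightarrow> (u, v) \<in> free_eq k"
  unfolding free_class_def by (rule eq_equiv_class_iff[OF equiv_free_eq])

lemma carrier_free_group: "carrier (free_group k) = free_class k ` words k"
  by (auto simp: free_group_def quotient_def free_class_def)

lemma mult_free_class:
  assumes "u \<in> words k" "v \<in> words k"
  shows "free_class k u \<otimes>\<^bsub>free_group k\<^esub> free_class k v = free_class k (u @ v)"
proof -
  have "free_eq k `` {u' @ v' | u' v'. u' \<in> free_class k u \<and> v' \<in> free_class k v} = free_eq k `` {u @ v}"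
  proof (intro equalityI subsetI)
    fix w assume "w \<in> free_eq k `` {u' @ v' | u' v'. u' \<in> free_class k u \<and> v' \<in> free_class k v}"
    then obtain u' v' where uv: "(u, u') \<in> free_eq k" "(v, v') \<in> free_eq k" "(u' @ v', w) \<in> free_eq k"
      by (auto simp: free_class_def)
    then have "(u @ v, u' @ v') \<in> free_eq k"
      using free_eq_append_left[OF uv(2) assms(1)] free_eq_append_right[OF uv(1), of v']
      by (meson free_eq_words free_eq.trans)
    then show "w \<in> free_eq k `` {u @ v}" using uv(3) by (auto intro: free_eq.trans)
  qed (use assms in \<open>auto simp: free_class_def intro: free_eq.refl\<close>)
  then show ?thesis by (simp add: free_group_def free_class_def)
qed

lemma one_free_group: "\<one>\<^bsub>free_group k\<^esub> = free_class k []"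
  by (simp add: free_group_def)

lemma free_eq_inv_word: "w \<in> words k \<Longrightarrow> (inv_word w @ w, []) \<in> free_eq k"
proof (induction w)
  case (Cons a w)
  then have aw: "a \<in> letters k" "w \<in> words k" by (auto simp: words_Cons)
  then have "(inv_word w @ [inv_letter a, inv_letter (inv_letter a)] @ w, inv_word w @ w) \<in> free_eq k"
    by (intro free_eq.cancel) (auto simp: inv_word_words inv_letter_letters)
  then show ?case
    using Cons.IH aw by (auto simp: inv_word_def inv_letter_inv_letter intro: free_eq.trans)
qed (simp add: inv_word_def free_eq.refl words_Nil)

lemma group_free_group: "group (free_group k)"
proof (rule groupI)
  show "\<exists>y\<in>carrier (free_group k). y \<otimes>\<^bsub>free_group k\<^esub> x = \<one>\<^bsub>free_group k\<^esub>"
    if "x \<in> carrier (free_group k)" for x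
  proof -
    from that obtain w where w: "w \<in> words k" "x = free_class k w"
      by (auto simp: carrier_free_group)
    then have "free_class k (inv_word w) \<otimes>\<^bsub>free_group k\<^esub> x = \<one>\<^bsub>free_group k\<^esub>"
      by (simp add: mult_free_class one_free_group inv_word_words free_class_eq_iff words_append words_Nil
          free_eq_inv_word)
    then show ?thesis using w(1) by (auto simp: carrier_free_group inv_word_words)
  qed
qed (auto simp: carrier_free_group mult_free_class one_free_group words_append words_Nil)

text \<open>Words congruent to the empty word are closed under products, inverses and conjugation,
  and \<open>f\<close> transports this to \<open>G\<close>. The target is the free group when a
  normal closure is computed, and the presented group, with an enlarged relator set, when just
  infiniteness is to be applied.\<close>

lemma normal_trivial_words:
  fixes G (structure)
  assumes "group G" and append: "\<And>u v. u \<in> words k \<Longrightarrow> v \<in> words k \<Longrightarrow> f (u @ v) = f u \<otimes> f v"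
    and onto: "f ` words k = carrier G"
    and free: "\<And>u v. (u, v) \<in> free_eq k \<Longrightarrow> f u = f v"
  shows "f ` {w \<in> words k. word_cong k R w []} \<lhd> G" (is "f ` ?W \<lhd> G")
proof -
  interpret group G by fact
  have carr: "f w \<in> carrier G" if "w \<in> words k" for w
    using onto that by blast
  have nil: "f [] = \<one>"
    using append[of "[]" "[]"] carr[of "[]"] by (simp add: words_Nil)
  have inv: "inv (f w) = f (inv_word w)" if "w \<in> words k" for w
    using that append[of "inv_word w" w] free[OF free_eq_inv_word[OF that]]
    by (intro inv_equality) (auto simp: nil carr inv_word_words)
  have "subgroup (f ` ?W) G"
  proof (rule subgroupI)
    show "f ` ?W \<subseteq> carrier G" using carr by auto
    show "f ` ?W \<noteq> {}" using word_cong.refl[of k R "[]"] words_Nil by blast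
  next
    fix a assume "a \<in> f ` ?W"
    then obtain w where w: "w \<in> words k" "word_cong k R w []" "a = f w" by auto
    have "word_cong k R (inv_word w @ []) (inv_word w @ w)"
      by (intro word_cong_append word_cong.refl word_cong.sym[OF w(2)])
    then have "word_cong k R (inv_word w) []"
      using word_cong_inv_word'[OF w(1)] word_cong.trans by fastforce
    then show "inv a \<in> f ` ?W" using w(1) by (auto simp: w(3) inv inv_word_words)
  next
    fix a b assume "a \<in> f ` ?W" "b \<in> f ` ?W"
    then obtain v w where "v \<in> ?W" "w \<in> ?W" "a = f v" "b = f w" by auto
    moreover from this have "v @ w \<in> ?W"
      using word_cong_append[of k R v "[]" w "[]"] by (simp add: words_append)
    ultimately show "a \<otimes> b \<in> f ` ?W" using append[of v w] by force
  qed
  moreover have "x \<otimes> h \<otimes> inv x \<in> f ` ?W" if "x \<in> carrier G" "h \<in> f ` ?W" for x h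
  proof -
    from that onto obtain u where u: "u \<in> words k" "x = f u" by blast
    from that obtain w where w: "w \<in> words k" "word_cong k R w []" "h = f w" by blast
    have "word_cong k R (u @ w @ inv_word u) (u @ [] @ inv_word u)"
      by (intro word_cong_append word_cong.refl w(2))
    then have "word_cong k R ((u @ w) @ inv_word u) []"
      using word_cong_inv_word[OF u(1)] word_cong.trans by fastforce
    then have mem: "(u @ w) @ inv_word u \<in> ?W"
      using u w by (simp add: words_append inv_word_words)
    have "f ((u @ w) @ inv_word u) = x \<otimes> h \<otimes> inv x"
      unfolding u(2) w(3) inv[OF u(1)] append[OF u(1) w(1), symmetric]
      by (rule append) (simp_all add: u(1) w(1) words_append inv_word_words)
    then show ?thesis by (intro rev_image_eqI[OF mem]) simp
  qed
  ultimately show ?thesis by (simp add: normal_inv_iff)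
qed

text \<open>Modulo \<open>M\<close> all relators become trivial and cosets multiply, so each rule
  preserves the coset. Leaving \<open>M\<close> arbitrary gives both the minimality of the explicit
  normal closure and the invariance of \<open>word_value\<close>.\<close>

lemma rcoset_free_class_cong:
  assumes M: "M \<lhd> free_group k" "free_class k ` R \<subseteq> M" and R: "R \<subseteq> words k"
    and uv: "word_cong k R u v" and u: "u \<in> words k"
  shows "M #>\<^bsub>free_group k\<^esub> free_class k u = M #>\<^bsub>free_group k\<^esub> free_class k v"
proof -
  interpret normal M "free_group k" by fact
  define h where "h w = M #>\<^bsub>free_group k\<^esub> free_class k w" for w
  have append: "h (u @ v) = h u <#>\<^bsub>free_group k\<^esub> h v" if "u \<in> words k" "v \<in> words k" for u v
    using that by (simp add: h_def rcos_sum carrier_free_group mult_free_class)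
  have rel: "h r = h []" if "r \<in> R" for r
  proof -
    have "free_class k r \<in> M" using M(2) that by blast
    then have "h r = M" unfolding h_def using subset by (intro coset_join2 subgroup_axioms) auto
    moreover have "h [] = M"
      using coset_mult_one[OF subset] by (simp add: h_def one_free_group)
    ultimately show ?thesis by simp
  qed
  \<comment> \<open>The alphabet condition travels through the induction, since multiplication by
    concatenation is available only for words over the alphabet.\<close>
  from uv u have "h u = h v"
  proof (induction rule: word_cong.induct)
    case (sym u v)
    then show ?case using word_cong_words[OF sym(1) R] by simp
  next
    case (trans u v w)
    then show ?case using word_cong_words[OF trans(1) R] by simp
  next
    case (Cons u v a)
    then have "u \<in> words k" "v \<in> words k" "[a] \<in> words k"
      using word_cong_words[OF Cons(1) R] by (auto simp: words_Cons words_Nil)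
    then show ?case using append[of "[a]"] Cons.IH by fastforce
  next
    case (cancel a u)
    then have "u \<in> words k" by (simp add: words_Cons)
    with cancel have "(a # inv_letter a # u, u) \<in> free_eq k"
      using free_eq.cancel[of "[]" k u a] by (simp add: words_Nil)
    then show ?case
      using free_class_eq_iff free_eq_words unfolding h_def by metis
  next
    case (rel r u)
    then have "r \<in> words k" "u \<in> words k" using R by (auto simp: words_append)
    then show ?case using append[of r u] append[of "[]" u] \<open>r \<in> R\<close> \<open>\<And>r. r \<in> R \<Longrightarrow> h r = h []\<close>
      by (simp add: words_Nil)
  qed simp
  then show ?thesis by (simp add: h_def)
qed

lemma free_class_eqI: "(u, v) \<in> free_eq k \<Longrightarrow> free_class k u = free_class k v"
  using free_class_eq_iff free_eq_words by blast

lemma normal_trivial_free_classes: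
  "free_class k ` {w \<in> words k. word_cong k R w []} \<lhd> free_group k"
  by (rule normal_trivial_words)
    (simp_all add: group_free_group mult_free_class carrier_free_group, rule free_class_eqI)

text \<open>The right-hand side is normal and contains the relators. Conversely, for any normal
  \<open>M\<close> containing them, a word congruent to the empty word has the same coset as the
  empty word, namely \<open>M\<close>. This avoids describing products of conjugates.\<close>

lemma relators_closure_eq:
  assumes R: "R \<subseteq> words k"
  shows "relators_closure k R = free_class k ` {w \<in> words k. word_cong k R w []}" (is "_ = ?N")
proof
  have "word_cong k R r []" if "r \<in> R" for r
    using word_cong.rel[OF that, of k "[]"] by simp
  then have "free_class k ` R \<subseteq> ?N" using R by blast
  then show "relators_closure k R \<subseteq> ?N"
    unfolding relators_closure_def normal_closure_def
    by (intro Inter_lower CollectI conjI normal_trivial_free_classes)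
next
  show "?N \<subseteq> relators_closure k R"
    unfolding relators_closure_def normal_closure_def
  proof (intro subsetI InterI)
    fix c M assume "c \<in> ?N" and "M \<in> {M. M \<lhd> free_group k \<and> free_class k ` R \<subseteq> M}"
    then obtain w where M: "M \<lhd> free_group k" "free_class k ` R \<subseteq> M"
      and w: "w \<in> words k" "word_cong k R w []" and c: "c = free_class k w" by auto
    interpret normal M "free_group k" by fact
    have "free_class k w \<in> carrier (free_group k)" using w by (simp add: carrier_free_group)
    then have "free_class k w \<in> M #>\<^bsub>free_group k\<^esub> free_class k w"
      by (rule rcos_self) (rule subgroup_axioms)
    also have "\<dots> = M #>\<^bsub>free_group k\<^esub> free_class k []"
      by (rule rcoset_free_class_cong[OF M R w(2,1)])
    also have "\<dots> = M"
      using coset_mult_one[OF subset] by (simp add: one_free_group)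
    finally show "c \<in> M" by (simp add: c)
  qed
qed

section \<open>Equality in the presented group\<close>

lemma normal_relators_closure: "R \<subseteq> words k \<Longrightarrow> relators_closure k R \<lhd> free_group k"
  by (simp add: relators_closure_eq normal_trivial_free_classes)

lemma word_value_append:
  assumes "R \<subseteq> words k" "u \<in> words k" "v \<in> words k"
  shows "word_value k R (u @ v) = word_value k R u \<otimes>\<^bsub>presented_group k R\<^esub> word_value k R v"
  using assms normal.rcos_sum[OF normal_relators_closure[OF assms(1)]]
  by (simp add: word_value_def presented_group_def FactGroup_def carrier_free_group mult_free_class)

lemma word_value_image: "word_value k R ` words k = carrier (presented_group k R)"
  by (auto simp: word_value_def presented_group_def FactGroup_def RCOSETS_def carrier_free_group)

lemma word_value_Nil:
  assumes "R \<subseteq> words k" shows "word_value k R [] = \<one>\<^bsub>presented_group k R\<^esub>"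
proof -
  interpret normal "relators_closure k R" "free_group k" by (rule normal_relators_closure) fact
  show ?thesis
    using coset_mult_one[OF subset]
    by (simp add: word_value_def presented_group_def FactGroup_def one_free_group)
qed

text \<open>Two words with the same coset differ in the free group by a factor from the closure,
  that is, by a word congruent to the empty one. This turns equality in the group into a relation
  that can be enumerated.\<close>

lemma word_value_eq_iff:
  assumes R: "R \<subseteq> words k" and uv: "u \<in> words k" "v \<in> words k"
  shows "word_value k R u = word_value k R v \<longleftrightarrow> word_cong k R u v"
proof
  interpret normal "relators_closure k R" "free_group k" by (rule normal_relators_closure) fact
  assume "word_value k R u = word_value k R v"
  moreover have "free_class k u \<in> word_value k R u"
    unfolding word_value_def using uv(1)
    by (intro rcos_self subgroup_axioms) (simp add: carrier_free_group)
  ultimately have "free_class k u \<in> word_value k R v" by simp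
  then obtain w where w: "w \<in> words k" "word_cong k R w []"
    and "free_class k u = free_class k w \<otimes>\<^bsub>free_group k\<^esub> free_class k v"
    unfolding word_value_def r_coset_def relators_closure_eq[OF R] by auto
  then have "(u, w @ v) \<in> free_eq k"
    using uv by (simp add: mult_free_class free_class_eq_iff words_append)
  then have "word_cong k R u (w @ v)" by (rule word_cong_free_eq)
  moreover have "word_cong k R (w @ v) ([] @ v)"
    by (intro word_cong_append w word_cong.refl)
  ultimately show "word_cong k R u v" by (metis append_Nil word_cong.trans)
next
  have "free_class k ` R \<subseteq> relators_closure k R"
    by (auto simp: relators_closure_def normal_closure_def)
  then show "word_value k R u = word_value k R v" if "word_cong k R u v"
    unfolding word_value_def
    using rcoset_free_class_cong[OF normal_relators_closure[OF R]] R that uv(1) by blast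
qed

text \<open>By induction on words, prepending one letter at a time, every word is congruent to one
  in \<open>F\<close>. The words in \<open>F\<close> may represent equal elements: \<open>F\<close>
  only bounds the order from above.\<close>

lemma finite_presented_group:
  assumes R: "R \<subseteq> words k" and F: "finite F" "[] \<in> F"
    and step: "\<And>u a. u \<in> F \<Longrightarrow> a \<in> letters k \<Longrightarrow> \<exists>v\<in>F. word_cong k R (a # u) v"
  shows "finite (carrier (presented_group k R))"
proof -
  have "\<exists>v\<in>F. word_cong k R w v" if "w \<in> words k" for w
    using that
  proof (induction w)
    case Nil
    then show ?case using F(2) word_cong.refl by blast
  next
    case (Cons a w)
    then obtain v where "v \<in> F" "word_cong k R w v" "a \<in> letters k" by (auto simp: words_Cons)
    then show ?case using step[of v a] by (meson word_cong.Cons word_cong.trans)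
  qed
  then have "\<exists>v\<in>F. word_value k R w = word_value k R v" if "w \<in> words k" for w
    using that word_value_eq_iff[OF R] word_cong_words[OF _ R] by metis
  then have "word_value k R ` words k \<subseteq> word_value k R ` F" by blast
  then show ?thesis
    using F(1) finite_subset unfolding word_value_image[symmetric] by blast
qed

text \<open>\<open>F\<close> consists of representatives of the cosets of \<open>H\<close>, the
  image in the presented group of the words that become trivial when \<open>x\<close> is added;
  \<open>H\<close> is nontrivial because it contains the value of \<open>x\<close>. Words in one
  coset are congruent modulo the enlarged relators.\<close>

lemma just_infinite_finite_quotient:
  assumes R: "R \<subseteq> words k" and G: "just_infinite (presented_group k R)"
    and x: "x \<in> words k" "word_value k R x \<noteq> \<one>\<^bsub>presented_group k R\<^esub>"
  shows "\<exists>F. finite F \<and> [] \<in> F \<and>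
    (\<forall>u\<in>F. \<forall>a\<in>letters k. \<exists>v\<in>F. word_cong k (insert x R) (a # u) v)"
proof -
  let ?G = "presented_group k R"
  interpret group ?G using G by (simp add: just_infinite_def)
  define H where "H = word_value k R ` {w \<in> words k. word_cong k (insert x R) w []}"
  have "H \<lhd> ?G"
    unfolding H_def
  proof (rule normal_trivial_words)
    show "word_value k R u = word_value k R v" if "(u, v) \<in> free_eq k" for u v
      using that free_class_eqI[OF that] by (simp add: word_value_def)
  qed (simp_all add: is_group word_value_append R word_value_image)
  moreover have "word_value k R x \<in> H"
    using x(1) word_cong.rel[of x "insert x R" k "[]"] by (auto simp: H_def)
  ultimately have fin: "finite (rcosets\<^bsub>?G\<^esub> H)"
    using G x(2) by (auto simp: just_infinite_def FactGroup_def)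
  interpret normal H ?G by fact
  have "\<exists>w\<in>words k. C = H #>\<^bsub>?G\<^esub> word_value k R w" if "C \<in> rcosets\<^bsub>?G\<^esub> H" for C
    using that by (auto simp: RCOSETS_def word_value_image[symmetric])
  then obtain r where r: "\<And>C. C \<in> rcosets\<^bsub>?G\<^esub> H \<Longrightarrow> r C \<in> words k"
    "\<And>C. C \<in> rcosets\<^bsub>?G\<^esub> H \<Longrightarrow> C = H #>\<^bsub>?G\<^esub> word_value k R (r C)"
    by metis
  \<comment> \<open>The representative chosen for \<open>H\<close> itself need not be the empty
    word, so the latter is added.\<close>
  let ?F = "insert [] (r ` (rcosets\<^bsub>?G\<^esub> H))"
  have "\<exists>v\<in>?F. word_cong k (insert x R) (a # u) v" if "u \<in> ?F" "a \<in> letters k" for a u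
  proof -
    have au: "a # u \<in> words k" using that r(1) by (auto simp: words_Cons words_Nil)
    then have carr: "word_value k R (a # u) \<in> carrier ?G" using word_value_image by blast
    define C where "C = H #>\<^bsub>?G\<^esub> word_value k R (a # u)"
    have C: "C \<in> rcosets\<^bsub>?G\<^esub> H" using carr by (auto simp: C_def RCOSETS_def)
    have "word_value k R (a # u) \<in> C"
      unfolding C_def by (intro rcos_self carr subgroup_axioms)
    then have "word_value k R (a # u) \<in> H #>\<^bsub>?G\<^esub> word_value k R (r C)"
      using r(2)[OF C] by simp
    then obtain h where h: "h \<in> words k" "word_cong k (insert x R) h []"
      and "word_value k R (a # u) = word_value k R h \<otimes>\<^bsub>?G\<^esub> word_value k R (r C)"
      by (auto simp: r_coset_def H_def)
    then have "word_cong k R (a # u) (h @ r C)"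
      using R r(1)[OF C] au by (simp add: word_value_append[symmetric] word_value_eq_iff words_append)
    then have "word_cong k (insert x R) (a # u) (h @ r C)"
      by (rule word_cong_mono) blast
    moreover have "word_cong k (insert x R) (h @ r C) ([] @ r C)"
      by (intro word_cong_append h word_cong.refl)
    ultimately have "word_cong k (insert x R) (a # u) (r C)"
      by (metis append_Nil word_cong.trans)
    then show ?thesis using C by blast
  qed
  then show ?thesis using fin by (intro exI[of _ ?F]) auto
qed

section \<open>Enumerating the congruence\<close>

lemma code_word_Nil: "code_word [] = 0"
  by (simp add: code_word_def)

lemma code_word_Cons: "code_word (a # w) = Suc (prod_encode (code_letter a, code_word w))"
  by (simp add: code_word_def)

lemma list_decode_code_word: "list_decode (code_word w) = map code_letter w"
  by (simp add: code_word_def)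

lemma code_word_eq_iff: "code_word u = code_word v \<longleftrightarrow> u = v"
  using inj_code_word by (auto simp: inj_def)

lemma surj_code_letter: "surj code_letter"
  by (rule surjI[of _ "\<lambda>n. (n div 2, even n)"]) auto

text \<open>Every number codes a word, so quantifiers over numbers in rules and certificates can be
  read as quantifiers over words.\<close>

lemma surj_code_word: "surj code_word"
  by (rule surjI[of _ "\<lambda>n. map (inv_into UNIV code_letter) (list_decode n)"])
    (simp add: code_word_def comp_def surj_f_inv_f[OF surj_code_letter])

text \<open>The rules on codes use \<open>i + i\<close> and \<open>Suc (i + i)\<close> for the two
  letters of generator \<open>i\<close>, in a form to which \<open>computable_intros\<close>
  applies.\<close>

lemma code_letter_even: "code_letter a = i + i \<longleftrightarrow> a = (i, True)"
  using inj_code_letter[THEN inj_eq, of a "(i, True)"] by (simp add: mult_2)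

lemma code_letter_odd: "code_letter a = Suc (i + i) \<longleftrightarrow> a = (i, False)"
  using inj_code_letter[THEN inj_eq, of a "(i, False)"] by (simp add: mult_2)

lemma code_letter_less_iff: "code_letter a < k + k \<longleftrightarrow> a \<in> letters k"
  by (cases a) (auto simp: letters_def)

lemma code_word_eq_Suc_iff:
  "code_word u = Suc (prod_encode (n, m)) \<longleftrightarrow>
    (\<exists>a w. u = a # w \<and> code_letter a = n \<and> code_word w = m)"
  by (cases u) (auto simp: code_word_Nil code_word_Cons)

text \<open>The word coded by \<open>x\<close> is a relator in addition to those enumerated by \<open>p\<close>.\<close>

definition word_rule :: "nat \<Rightarrow> nat \<Rightarrow> nat \<Rightarrow> nat set \<Rightarrow> nat \<Rightarrow> nat \<Rightarrow> bool" where
  "word_rule k p x A u v \<longleftrightarrow>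
    u = v \<or> prod_encode (v, u) \<in> A \<or>
    (\<exists>w. prod_encode (u, w) \<in> A \<and> prod_encode (w, v) \<in> A) \<or>
    (\<exists>a m n. u = Suc (prod_encode (a, m)) \<and> v = Suc (prod_encode (a, n)) \<and>
      prod_encode (m, n) \<in> A) \<or>
    (\<exists>i<k. u = Suc (prod_encode (i + i, Suc (prod_encode (Suc (i + i), v)))) \<or>
      u = Suc (prod_encode (Suc (i + i), Suc (prod_encode (i + i, v))))) \<or>
    (\<exists>r. (r = x \<or> (\<exists>n. derivable run_step (run_fact p (Suc (prod_encode (n, 0))) r))) \<and>
      list_decode u = list_decode r @ list_decode v)"

definition word_step :: "nat \<Rightarrow> nat \<Rightarrow> nat \<Rightarrow> nat set \<Rightarrow> nat \<Rightarrow> bool" where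
  "word_step k p x A c \<longleftrightarrow> word_rule k p x A (fst (prod_decode c)) (snd (prod_decode c))"

lemma word_step_mono: "A \<subseteq> B \<Longrightarrow> word_step k p x A c \<Longrightarrow> word_step k p x B c"
  unfolding word_step_def word_rule_def
  by (elim disj_forward ex_forward conj_forward; (assumption | erule (1) subsetD))

lemma semidecidable_append:
  assumes "computable f" "computable g" "computable h"
  shows "semidecidable (\<lambda>e. list_decode (f e) = list_decode (g e) @ list_decode (h e))"
proof -
  \<comment> \<open>Concatenation as bounded comparison: equal entries up to the length of
    \<open>xs\<close>, then an equal remainder. The strict inequality with \<open>Suc\<close>
    expresses \<le> and guards the accesses \<open>zs ! i\<close>.\<close>
  have eq: "zs = xs @ ys \<longleftrightarrow>
      length xs < Suc (length zs) \<and> (\<forall>i<length xs. zs ! i = xs ! i) \<and> drop (length xs) zs = ys"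
    for xs ys zs :: "nat list"
  proof
    assume "length xs < Suc (length zs) \<and> (\<forall>i<length xs. zs ! i = xs ! i) \<and> drop (length xs) zs = ys"
    then have "take (length xs) zs = xs" "drop (length xs) zs = ys"
      by (auto intro: nth_equalityI)
    then show "zs = xs @ ys" by (metis append_take_drop_id)
  qed (auto simp: nth_append)
  have "list_decode n = list_decode l @ list_decode m \<longleftrightarrow>
      length (list_decode l) < Suc (length (list_decode n)) \<and>
      (\<forall>i<length (list_decode l). nth_code n i = nth_code l i) \<and>
      list_encode (drop (length (list_decode l)) (list_decode n)) = m" for l m n
    unfolding eq by (metis less_Suc_eq_le less_le_trans list_decode_inverse list_encode_inverse nth_code_eq)
  then show ?thesis
    by (simp only:) (intro semidecidable_intros computable_drop computable_compose[OF assms(1)]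
        computable_compose[OF assms(2)] computable_compose[OF assms(3)] assms)
qed

lemma semidecidable_derivable_word_step:
  assumes "computable k" "computable p" "computable x" "computable g"
  shows "semidecidable (\<lambda>e. derivable (word_step (k e) (p e) (x e)) (g e))"
proof -
  \<comment> \<open>Packing \<open>k\<close>, \<open>p\<close> and \<open>x\<close> into one number
    turns them into the single parameter of \<open>semidecidable_derivable\<close>.\<close>
  let ?S = "\<lambda>n. word_step (fst (prod_decode n)) (fst (prod_decode (snd (prod_decode n))))
    (snd (prod_decode (snd (prod_decode n))))"
  have "semidecidable (\<lambda>e. derivable (?S (prod_encode (k e, prod_encode (p e, x e)))) (g e))"
  proof (rule semidecidable_derivable)
    show "semidecidable (\<lambda>e. ?S (fst (prod_decode e))
      (set (list_decode (fst (prod_decode (snd (prod_decode e))))))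
      (snd (prod_decode (snd (prod_decode e)))))"
      unfolding word_step_def word_rule_def
      by (intro semidecidable_intros semidecidable_derivable_run_step semidecidable_append)
  qed (erule (1) word_step_mono | intro computable_intros assms)+
  then show ?thesis by simp
qed

lemma derivable_word_step_iff:
  assumes p: "re_presentation k p R"
  shows "derivable (word_step k (code_program p) (code_word x)) (prod_encode (code_word u, code_word v))
    \<longleftrightarrow> word_cong k (insert x R) u v" (is "derivable ?S _ \<longleftrightarrow> _")
proof
  \<comment> \<open>Inputs on which \<open>p\<close> diverges have no run fact, so exactly the codes
    of \<open>R\<close> appear besides the code of \<open>x\<close>.\<close>
  have R: "r = code_word x \<or> (\<exists>n. derivable run_step (run_fact (code_program p) (Suc (prod_encode (n, 0))) r))
      \<longleftrightarrow> r \<in> code_word ` insert x R" for r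
  proof -
    have "derivable run_step (run_fact (code_program p) (Suc (prod_encode (n, 0))) r) \<longleftrightarrow> run p [n] = Some r" for n
      by (simp add: run_iff_derivable)
    moreover have "(\<exists>n. run p [n] = Some r) \<longleftrightarrow> r \<in> code_word ` R"
      using p unfolding re_presentation_def enumerates_def by blast
    ultimately show ?thesis by simp
  qed
  \<comment> \<open>Decoded, the disjuncts match the rules of \<open>word_cong\<close> one by one,
    so both directions become inductions rule by rule.\<close>
  have step: "?S A (prod_encode (code_word u, code_word v)) \<longleftrightarrow>
      u = v \<or> prod_encode (code_word v, code_word u) \<in> A \<or>
      (\<exists>w. prod_encode (code_word u, code_word w) \<in> A \<and> prod_encode (code_word w, code_word v) \<in> A) \<or>
      (\<exists>a u' v'. u = a # u' \<and> v = a # v' \<and> prod_encode (code_word u', code_word v') \<in> A) \<or>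
      (\<exists>a\<in>letters k. u = a # inv_letter a # v) \<or> (\<exists>r\<in>insert x R. u = r @ v)" for A u v
  proof -
    have e1: "(\<exists>w. prod_encode (code_word u, w) \<in> A \<and> prod_encode (w, code_word v) \<in> A) \<longleftrightarrow>
      (\<exists>w. prod_encode (code_word u, code_word w) \<in> A \<and> prod_encode (code_word w, code_word v) \<in> A)"
      using surj_code_word by (metis surjE)
    have e2: "(\<exists>a m n. code_word u = Suc (prod_encode (a, m)) \<and> code_word v = Suc (prod_encode (a, n)) \<and>
        prod_encode (m, n) \<in> A) \<longleftrightarrow>
      (\<exists>a u' v'. u = a # u' \<and> v = a # v' \<and> prod_encode (code_word u', code_word v') \<in> A)"
      by (auto simp: code_word_eq_Suc_iff inj_eq[OF inj_code_letter]
          simp del: code_letter.simps split_paired_Ex)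
    have e3: "(\<exists>i<k. code_word u = Suc (prod_encode (i + i, Suc (prod_encode (Suc (i + i), code_word v)))) \<or>
       code_word u = Suc (prod_encode (Suc (i + i), Suc (prod_encode (i + i, code_word v))))) \<longleftrightarrow>
      (\<exists>a\<in>letters k. u = a # inv_letter a # v)"
    proof -
      have "code_word u = Suc (prod_encode (i + i, Suc (prod_encode (Suc (i + i), code_word v)))) \<longleftrightarrow>
          u = (i, True) # (i, False) # v"
        "code_word u = Suc (prod_encode (Suc (i + i), Suc (prod_encode (i + i, code_word v)))) \<longleftrightarrow>
          u = (i, False) # (i, True) # v" for i
        by (auto simp: code_word_eq_Suc_iff code_letter_even code_letter_odd code_word_eq_iff
            code_word_Cons mult_2)
      then show ?thesis by (auto simp: letters_def ex_bool_eq)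
    qed
    have e4: "(\<exists>r\<in>code_word ` insert x R.
        list_decode (code_word u) = list_decode r @ list_decode (code_word v)) \<longleftrightarrow>
      (\<exists>r\<in>insert x R. u = r @ v)"
      unfolding bex_simps(7) list_decode_code_word map_append[symmetric]
        inj_map_eq_map[OF inj_code_letter] ..
    show ?thesis
      unfolding word_step_def prod_encode_inverse fst_conv snd_conv word_rule_def R
        Bex_def[symmetric] e1 e2 e3 e4 code_word_eq_iff ..
  qed
  show "word_cong k (insert x R) u v" if "derivable ?S (prod_encode (code_word u, code_word v))"
  proof -
    have "word_cong k (insert x R) u v" if "derivable ?S c" "c = prod_encode (code_word u, code_word v)" for c u v
      using that
    proof (induction arbitrary: u v)
      case (derivableI A c)
      have IH: "word_cong k (insert x R) u v" if "prod_encode (code_word u, code_word v) \<in> A" for u v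
        using derivableI.IH that by blast
      have "?S A (prod_encode (code_word u, code_word v))" using derivableI by simp
      then show ?case
        unfolding step by (elim disjE exE conjE bexE) (auto intro: IH word_cong.intros)
    qed
    then show ?thesis using that by blast
  qed
  show "derivable ?S (prod_encode (code_word u, code_word v))" if "word_cong k (insert x R) u v"
    using that
  proof (induction rule: word_cong.induct)
    case (trans u v w)
    show ?case by (rule derivable_insert2[OF trans.IH]) (auto simp: step)
  next
    case (sym u v)
    show ?case by (rule derivable_insert2[OF sym.IH sym.IH]) (auto simp: step)
  next
    case (Cons u v a)
    show ?case by (rule derivable_insert2[OF Cons.IH Cons.IH]) (auto simp: step)
  qed (rule derivable_empty, subst step, blast)+
qed

section \<open>The decision procedure\<close>

theorem theorem1:
  shows "\<exists>A :: program. \<forall>(k :: nat) (p :: program) (R :: word set) (x :: word).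
    re_presentation k p R \<longrightarrow> just_infinite (presented_group k R) \<longrightarrow> x \<in> words k \<longrightarrow>
      run A [code_presentation k p, code_word x] =
        Some (if word_value k R x = \<one>\<^bsub>presented_group k R\<^esub> then 1 else 0)"
proof -
  \<comment> \<open>Code 0 is the empty word. As the extra relator it changes nothing, so the same
    rule system serves for \<open>R\<close> alone; as the right-hand side it expresses
    triviality.\<close>
  define P where "P e \<longleftrightarrow> derivable (word_step (fst (prod_decode (fst (prod_decode e))))
      (snd (prod_decode (fst (prod_decode e)))) 0) (prod_encode (snd (prod_decode e), 0))" for e
  \<comment> \<open>\<open>l\<close> codes the finite set of words. The codes of letters, inverses
    included, are the numbers below twice the number of generators, and
    \<open>Suc (prod_encode (a, nth_code l i))\<close> codes the \<open>i\<close>-th word with a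
    letter prepended.\<close>
  define Q where "Q e \<longleftrightarrow> (\<exists>l. 0 \<in> set (list_decode l) \<and> (\<forall>i<length (list_decode l).
      \<forall>a<fst (prod_decode (fst (prod_decode e))) + fst (prod_decode (fst (prod_decode e))).
      \<exists>v. v \<in> set (list_decode l) \<and>
        derivable (word_step (fst (prod_decode (fst (prod_decode e))))
          (snd (prod_decode (fst (prod_decode e)))) (snd (prod_decode e)))
          (prod_encode (Suc (prod_encode (a, nth_code l i)), v))))" for e
  have "semidecidable P" "semidecidable Q"
    unfolding P_def[abs_def] Q_def[abs_def]
    by (intro semidecidable_intros semidecidable_derivable_word_step)+
  then obtain A where A: "\<And>a b. P (prod_encode (a, b)) \<noteq> Q (prod_encode (a, b)) \<Longrightarrow>
      run A [a, b] = Some (if P (prod_encode (a, b)) then 1 else 0)"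
    using decide_complementary by blast
  show ?thesis
  proof (intro exI[of _ A] allI impI)
    fix k p R x
    assume p: "re_presentation k p R" and G: "just_infinite (presented_group k R)" and x: "x \<in> words k"
    let ?e = "prod_encode (code_presentation k p, code_word x)"
    have R: "R \<subseteq> words k" using p by (simp add: re_presentation_def)
    have one_iff: "word_value k R x = \<one>\<^bsub>presented_group k R\<^esub> \<longleftrightarrow> word_cong k R x []"
      using word_value_eq_iff[OF R x words_Nil] word_value_Nil[OF R] by simp
    have P: "P ?e \<longleftrightarrow> word_value k R x = \<one>\<^bsub>presented_group k R\<^esub>"
    proof -
      have "P ?e \<longleftrightarrow> word_cong k (insert [] R) x []"
        using derivable_word_step_iff[OF p, of "[]" x "[]"]
        by (simp add: P_def code_presentation_def code_word_Nil)
      also have "\<dots> \<longleftrightarrow> word_cong k R x []"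
        using word_cong_drop_trivial_relator[OF _ word_cong.refl] word_cong_mono[OF _ subset_insertI]
        by blast
      finally show ?thesis by (simp add: one_iff)
    qed
    have Q: "Q ?e \<longleftrightarrow> (\<exists>F. finite F \<and> [] \<in> F \<and>
      (\<forall>u\<in>F. \<forall>a\<in>letters k. \<exists>v\<in>F. word_cong k (insert x R) (a # u) v))"
    proof -
      have "Q ?e \<longleftrightarrow> (\<exists>l. 0 \<in> set (list_decode l) \<and> (\<forall>u\<in>set (list_decode l). \<forall>a<k + k.
          \<exists>v\<in>set (list_decode l). derivable (word_step k (code_program p) (code_word x))
            (prod_encode (Suc (prod_encode (a, u)), v))))"
        by (simp add: Q_def code_presentation_def nth_code_eq all_set_conv_all_nth Bex_def)
      also have "\<dots> \<longleftrightarrow> (\<exists>F. finite F \<and> 0 \<in> F \<and> (\<forall>u\<in>F. \<forall>a<k + k.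
          \<exists>v\<in>F. derivable (word_step k (code_program p) (code_word x))
            (prod_encode (Suc (prod_encode (a, u)), v))))"
        by (metis (no_types, lifting) finite_list finite_set list_encode_inverse)
      also have "\<dots> \<longleftrightarrow> (\<exists>F. finite (code_word ` F) \<and> 0 \<in> code_word ` F \<and> (\<forall>u\<in>code_word ` F. \<forall>a<k + k.
          \<exists>v\<in>code_word ` F. derivable (word_step k (code_program p) (code_word x))
            (prod_encode (Suc (prod_encode (a, u)), v))))"
      proof -
        \<comment> \<open>By surjectivity of the coding every set of numbers is the image of its
          preimage.\<close>
        have "\<exists>F. N = code_word ` F" for N
          by (metis surj_image_vimage_eq surj_code_word)
        then show ?thesis by metis
      qed
      also have "\<dots> \<longleftrightarrow> (\<exists>F. finite F \<and> [] \<in> F \<and>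
        (\<forall>u\<in>F. \<forall>a\<in>letters k. \<exists>v\<in>F. word_cong k (insert x R) (a # u) v))"
      proof -
        have "(\<forall>a<k + k. f a) \<longleftrightarrow> (\<forall>a\<in>letters k. f (code_letter a))" for f
          by (metis surjE[OF surj_code_letter] code_letter_less_iff)
        moreover have "0 \<in> code_word ` F \<longleftrightarrow> [] \<in> F" for F
          by (metis code_word_Nil code_word_eq_iff image_iff)
        moreover have "finite (code_word ` F) \<longleftrightarrow> finite F" for F
          by (metis finite_imageD finite_imageI inj_code_word inj_on_subset subset_UNIV)
        ultimately show ?thesis
          by (simp add: code_word_Cons[symmetric] derivable_word_step_iff[OF p])
      qed
      finally show ?thesis .
    qed
    have "P ?e \<noteq> Q ?e"
    proof (cases "word_value k R x = \<one>\<^bsub>presented_group k R\<^esub>")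
      case True
      have "\<not> Q ?e"
      proof
        assume "Q ?e"
        then obtain F where F: "finite F" "[] \<in> F"
          "\<And>u a. u \<in> F \<Longrightarrow> a \<in> letters k \<Longrightarrow> \<exists>v\<in>F. word_cong k (insert x R) (a # u) v"
          unfolding Q by blast
        \<comment> \<open>Here \<open>x\<close> is a consequence of \<open>R\<close>, so the
          certificate is valid for the group itself.\<close>
        then have "finite (carrier (presented_group k R))"
          using True word_cong_drop_trivial_relator unfolding one_iff
          by (intro finite_presented_group[OF R, of F]) blast+
        then show False using G by (simp add: just_infinite_def)
      qed
      then show ?thesis using True P by simp
    next
      case False
      then show ?thesis using P Q just_infinite_finite_quotient[OF R G x] by simp
    qed
    from A[OF this] show "run A [code_presentation k p, code_word x] =
        Some (if word_value k R x = \<one>\<^bsub>presented_group k R\<^esub> then 1 else 0)"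
      using P by simp
  qed
qed

end
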